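(* Let $dOH$ be the complete extension of $OH$ induced by the interpolation couple $(R,C)$ at $\theta=\frac12$, and let $do(\ell_2)$ be the complete extension of $OH$ induced by the interpolation couple $(\min(\ell_2),\max(\ell_2))$ at $\theta=\frac12$. Then $dOH$ and $do(\ell_2)$ are not completely isomorphically equivalent, i.e. there are no complete isomorphisms $\alpha:OH\to OH$, $\beta:dOH\to do(\ell_2)$, $\gamma:OH\to OH$ making the diagram with rows $0\to OH\to dOH\to OH\to0$ and $0\to OH\to do(\ell_2)\to OH\to0$ commute.
   Context: $R$, $C$, $OH$ are the operator space structures on $\ell_2$ given, for $x_k\in M_n$ and $(e_k)$ an orthonormal basis, by $\|\sum x_k\otimes e_k\|_{M_n(R)}=\|\sum x_kx_k^*\|^{1/2}$, $\|\sum x_k\otimes e_k\|_{M_n(C)}=\|\sum x_k^*x_k\|^{1/2}$, $\|\sum x_k\otimes e_k\|_{M_n(OH)}=\|\sum x_k\otimes\overline{x_k}\|^{1/2}$. For a Banach space $X$: $\|x\|_{M_n(\min(X))}=\sup\{\|(f(x_{ij}))\|_{M_n}:f\in X^*,\|f\|\le1\}$ and $\|x\|_{M_n(\max(X))}=\inf\{\|A\|\|D\|\|B\|\}$ over factorizations $x=ADB$ with $A,B$ scalar matrices and $D$ diagonal with entries in $X$. It is known that $OH=(\min(\ell_2),\max(\ell_2))_{1/2}=(R,C)_{1/2}$ (all couples being compatible via the identity of $\ell_2$). Complex interpolation: for a compatible couple $(X_0,X_1)$ of operator spaces, $\Sigma=X_0+X_1$ with norm $\inf\{\|x_0\|_{X_0}+\|x_1\|_{X_1}:x=x_0+x_1\}$,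 $\mathbb S=\{0\le\mathrm{Re}\,z\le1\}$. $\mathcal F(X_0,X_1)$ is the Banach space of functions $f:\mathbb S\to\Sigma$ bounded and continuous on $\mathbb S$, analytic in its interior, with $f(it)\in X_0$, $f(1+it)\in X_1$ and $t\mapsto\|f(it)\|_{X_0}$, $t\mapsto\|f(1+it)\|_{X_1}$ bounded and continuous, with norm $\max\{\sup_t\|f(it)\|_{X_0},\sup_t\|f(1+it)\|_{X_1}\}$ and operator space structure $M_n(\mathcal F(X_0,X_1))=\mathcal F(M_n(X_0),M_n(X_1))$. With $\delta_\theta(f)=f(\theta)$, $\delta_\theta'(f)=f'(\theta)$: $X_\theta=(X_0,X_1)_\theta=\mathcal F/\ker\delta_\theta$ and $dX_\theta=\mathcal F/(\ker\delta_\theta\cap\ker\delta_\theta')=\{(f(\theta),f'(\theta)):f\in\mathcal F\}$ with quotient operator space structures ($M_n(X/Y)=M_n(X)/M_n(Y)$). The complete extension of $X_\theta$ induced by the couple is $0\to X_\theta\to dX_\theta\to X_\theta\to0$ with inclusion $y\mapsto(0,y)$ and quotient map $(x,y)\mapsto x$. A complete isomorphism is an invertible linear map $T$ such that $T$ and $T^{-1}$ are completely bounded. *)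

theory Defs
  imports "HOL-Analysis.Analysis" "HOL-Library.Function_Algebras"
begin

class complex_vector = ab_group_add +
  fixes scaleC :: "complex \<Rightarrow> 'a \<Rightarrow> 'a" (infixr "*\<^sub>C" 75)
  assumes scaleC_add_right: "a *\<^sub>C (x + y) = a *\<^sub>C x + a *\<^sub>C y"
    and scaleC_add_left: "(a + b) *\<^sub>C x = a *\<^sub>C x + b *\<^sub>C x"
    and scaleC_scaleC: "a *\<^sub>C (b *\<^sub>C x) = (a * b) *\<^sub>C x"
    and scaleC_one: "1 *\<^sub>C x = x"

instantiation complex :: complex_vector
begin
definition "a *\<^sub>C (x::complex) = a * x"
instance by standard (simp_all add: scaleC_complex_def algebra_simps)
end

instantiation "fun" :: (type, complex_vector) complex_vector
begin
definition "a *\<^sub>C f = (\<lambda>x. a *\<^sub>C f x)"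
instance
  by standard (simp_all add: scaleC_fun_def fun_eq_iff scaleC_add_right scaleC_add_left
      scaleC_scaleC scaleC_one)
end

instantiation prod :: (complex_vector, complex_vector) complex_vector
begin
definition "a *\<^sub>C p = (a *\<^sub>C fst p, a *\<^sub>C snd p)"
instance
  by standard (simp_all add: scaleC_prod_def prod_eq_iff scaleC_add_right scaleC_add_left
      scaleC_scaleC scaleC_one)
end

definition clinear_on :: "'a::complex_vector set \<Rightarrow> ('a \<Rightarrow> 'b::complex_vector) \<Rightarrow> bool" where
  "clinear_on V T \<longleftrightarrow>
     (\<forall>x\<in>V. \<forall>y\<in>V. T (x + y) = T x + T y) \<and> (\<forall>c. \<forall>x\<in>V. T (c *\<^sub>C x) = c *\<^sub>C T x)"

text \<open>
  Spaces are subspaces of an ambient vector space (a type of class \<^class>\<open>complex_vector\<close>), so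
  that a couple living in the same ambient space is compatible via the identity. An element of
  \<open>M\<^sub>n(V)\<close> is a function of two indices with entries in \<open>V\<close> that vanishes unless both
  indices are below \<open>n\<close>.
\<close>

record 'a nspace =
  ncarrier :: "'a set"
  nnorm :: "'a \<Rightarrow> real"

record 'a opspace =
  carrier :: "'a set"
  mnorm :: "nat \<Rightarrow> (nat \<Rightarrow> nat \<Rightarrow> 'a) \<Rightarrow> real"

definition mats :: "nat \<Rightarrow> 'a::zero set \<Rightarrow> (nat \<Rightarrow> nat \<Rightarrow> 'a) set" where
  "mats n V = {x. \<forall>i j. if i < n \<and> j < n then x i j \<in> V else x i j = 0}"

definition matspace :: "nat \<Rightarrow> 'a::zero opspace \<Rightarrow> (nat \<Rightarrow> nat \<Rightarrow> 'a) nspace" where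
  "matspace n X = \<lparr>ncarrier = mats n (carrier X), nnorm = mnorm X n\<rparr>"

definition underlying :: "'a::zero opspace \<Rightarrow> 'a nspace" where
  "underlying X = \<lparr>ncarrier = carrier X,
     nnorm = (\<lambda>x. mnorm X 1 (\<lambda>i j. if i = 0 \<and> j = 0 then x else 0))\<rparr>"

text \<open>
  Operator norm of a scalar matrix with rows indexed by \<open>I\<close> and columns by \<open>J\<close> (finite sets),
  acting from \<open>\<ell>\<^sub>2(J)\<close> to \<open>\<ell>\<^sub>2(I)\<close>.
\<close>

definition opnorm :: "'i set \<Rightarrow> 'j set \<Rightarrow> ('i \<Rightarrow> 'j \<Rightarrow> complex) \<Rightarrow> real" where
  "opnorm I J A = (SUP v\<in>{v. L2_set (\<lambda>j. cmod (v j)) J \<le> 1}.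
     L2_set (\<lambda>i. cmod (\<Sum>j\<in>J. A i j * v j)) I)"


definition ell2 :: "(nat \<Rightarrow> complex) nspace" where
  "ell2 = \<lparr>ncarrier = {x. summable (\<lambda>k. (cmod (x k))\<^sup>2)},
     nnorm = (\<lambda>x. sqrt (\<Sum>k. (cmod (x k))\<^sup>2))\<rparr>"

text \<open>
  For \<open>x \<in> M\<^sub>n(\<ell>\<^sub>2)\<close> the coefficient matrix \<open>x\<^sub>k\<close> of the basis vector \<open>e\<^sub>k\<close> is
  \<open>\<lambda>i j. x i j k\<close>. The three matrices below are \<open>\<Sum>\<^sub>k x\<^sub>k x\<^sub>k\<^sup>*\<close>, \<open>\<Sum>\<^sub>k x\<^sub>k\<^sup>* x\<^sub>k\<close> and the
  Kronecker product sum \<open>\<Sum>\<^sub>k x\<^sub>k \<otimes> cnj x\<^sub>k\<close>, whose rows and columns are indexed by pairs.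
\<close>

definition row_os :: "(nat \<Rightarrow> complex) opspace" where
  "row_os = \<lparr>carrier = ncarrier ell2,
     mnorm = (\<lambda>n x. sqrt (opnorm {..<n} {..<n}
       (\<lambda>i j. \<Sum>k. \<Sum>l<n. x i l k * cnj (x j l k))))\<rparr>"

definition col_os :: "(nat \<Rightarrow> complex) opspace" where
  "col_os = \<lparr>carrier = ncarrier ell2,
     mnorm = (\<lambda>n x. sqrt (opnorm {..<n} {..<n}
       (\<lambda>i j. \<Sum>k. \<Sum>l<n. cnj (x l i k) * x l j k)))\<rparr>"

definition OH :: "(nat \<Rightarrow> complex) opspace" where
  "OH = \<lparr>carrier = ncarrier ell2,
     mnorm = (\<lambda>n x. sqrt (opnorm ({..<n} \<times> {..<n}) ({..<n} \<times> {..<n})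
       (\<lambda>(i, p) (j, q). \<Sum>k. x i j k * cnj (x p q k))))\<rparr>"

definition dual_ball :: "'a::complex_vector nspace \<Rightarrow> ('a \<Rightarrow> complex) set" where
  "dual_ball X = {f. clinear_on (ncarrier X) f \<and> (\<forall>x\<in>ncarrier X. cmod (f x) \<le> nnorm X x)}"

definition min_os :: "'a::complex_vector nspace \<Rightarrow> 'a opspace" where
  "min_os X = \<lparr>carrier = ncarrier X,
     mnorm = (\<lambda>n x. SUP f\<in>dual_ball X. opnorm {..<n} {..<n} (\<lambda>i j. f (x i j)))\<rparr>"

text \<open>
  In \<open>x = A D B\<close> the matrix \<open>A\<close> is \<open>n \<times> m\<close>, \<open>B\<close> is \<open>m \<times> n\<close> and \<open>D\<close> is the diagonal matrix with
  entries \<open>d 0, \<dots>, d (m - 1)\<close>, so that \<open>\<parallel>D\<parallel>\<close> is the maximum of the norms of its entries.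
\<close>

definition max_os :: "'a::complex_vector nspace \<Rightarrow> 'a opspace" where
  "max_os X = \<lparr>carrier = ncarrier X,
     mnorm = (\<lambda>n x. Inf {opnorm {..<n} {..<m} A * Max ((\<lambda>k. nnorm X (d k)) ` {..<m})
                          * opnorm {..<m} {..<n} B | (m::nat) A d B.
       m > 0 \<and> (\<forall>k<m. d k \<in> ncarrier X) \<and>
       (\<forall>i<n. \<forall>j<n. x i j = (\<Sum>k<m. (A i k * B k j) *\<^sub>C d k))})\<rparr>"


definition sum_space :: "'a::ab_group_add nspace \<Rightarrow> 'a nspace \<Rightarrow> 'a nspace" where
  "sum_space X0 X1 =
     \<lparr>ncarrier = {x0 + x1 | x0 x1. x0 \<in> ncarrier X0 \<and> x1 \<in> ncarrier X1},
      nnorm = (\<lambda>x. Inf {nnorm X0 x0 + nnorm X1 x1 | x0 x1.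
        x0 \<in> ncarrier X0 \<and> x1 \<in> ncarrier X1 \<and> x = x0 + x1})\<rparr>"

definition has_nderiv ::
  "'a::complex_vector nspace \<Rightarrow> (complex \<Rightarrow> 'a) \<Rightarrow> 'a \<Rightarrow> complex \<Rightarrow> bool" where
  "has_nderiv X f d z \<longleftrightarrow> d \<in> ncarrier X \<and>
     ((\<lambda>w. nnorm X ((1 / (w - z)) *\<^sub>C (f w - f z) - d)) \<longlongrightarrow> 0) (at z)"

definition nderiv ::
  "'a::complex_vector nspace \<Rightarrow> (complex \<Rightarrow> 'a) \<Rightarrow> complex \<Rightarrow> 'a" where
  "nderiv X f z = (THE d. has_nderiv X f d z)"

definition strip :: "complex set" where
  "strip = {z. 0 \<le> Re z \<and> Re z \<le> 1}"

text \<open>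
  Only the values on \<^const>\<open>strip\<close> of a member of the following set matter; its values elsewhere
  are arbitrary. Analyticity is complex differentiability in the norm of the sum space.
\<close>

definition calF ::
  "'a::complex_vector nspace \<Rightarrow> 'a nspace \<Rightarrow> (complex \<Rightarrow> 'a) set" where
  "calF X0 X1 = {f.
     (\<forall>z\<in>strip. f z \<in> ncarrier (sum_space X0 X1)) \<and>
     (\<exists>B. \<forall>z\<in>strip. nnorm (sum_space X0 X1) (f z) \<le> B) \<and>
     (\<forall>z\<in>strip. ((\<lambda>w. nnorm (sum_space X0 X1) (f w - f z)) \<longlongrightarrow> 0) (at z within strip)) \<and>
     (\<forall>z\<in>interior strip. \<exists>d. has_nderiv (sum_space X0 X1) f d z) \<and>
     (\<forall>t::real. f (\<i> * of_real t) \<in> ncarrier X0) \<and>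
     (\<forall>t::real. f (1 + \<i> * of_real t) \<in> ncarrier X1) \<and>
     bounded (range (\<lambda>t::real. nnorm X0 (f (\<i> * of_real t)))) \<and>
     continuous_on UNIV (\<lambda>t::real. nnorm X0 (f (\<i> * of_real t))) \<and>
     bounded (range (\<lambda>t::real. nnorm X1 (f (1 + \<i> * of_real t)))) \<and>
     continuous_on UNIV (\<lambda>t::real. nnorm X1 (f (1 + \<i> * of_real t)))}"

definition calF_norm :: "'a nspace \<Rightarrow> 'a nspace \<Rightarrow> (complex \<Rightarrow> 'a) \<Rightarrow> real" where
  "calF_norm X0 X1 f = max (SUP t::real. nnorm X0 (f (\<i> * of_real t)))
                           (SUP t::real. nnorm X1 (f (1 + \<i> * of_real t)))"

text \<open>
  A matrix of functions is identified with a matrix-valued function: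
  \<open>M\<^sub>n(F(X\<^sub>0, X\<^sub>1)) = F(M\<^sub>n(X\<^sub>0), M\<^sub>n(X\<^sub>1))\<close>.
\<close>

definition F_os ::
  "'a::complex_vector opspace \<Rightarrow> 'a opspace \<Rightarrow> (complex \<Rightarrow> 'a) opspace" where
  "F_os X0 X1 = \<lparr>carrier = calF (underlying X0) (underlying X1),
     mnorm = (\<lambda>n f. calF_norm (matspace n X0) (matspace n X1) (\<lambda>z i j. f i j z))\<rparr>"

text \<open>
  The quotient operator space \<open>X / ker q\<close> of \<open>X\<close>, for a linear map \<open>q\<close>, realised on the image of
  \<open>q\<close>; the norm on \<open>M\<^sub>n(X / ker q)\<close> is the quotient norm of \<open>M\<^sub>n(X) / M\<^sub>n(ker q)\<close>.
\<close>

definition quotient_os :: "'a::zero opspace \<Rightarrow> ('a \<Rightarrow> 'b) \<Rightarrow> 'b opspace" where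
  "quotient_os X q = \<lparr>carrier = q ` carrier X,
     mnorm = (\<lambda>n y. Inf {mnorm X n x | x.
       x \<in> mats n (carrier X) \<and> (\<forall>i<n. \<forall>j<n. q (x i j) = y i j)})\<rparr>"

definition d_interp ::
  "complex \<Rightarrow> 'a::complex_vector opspace \<Rightarrow> 'a opspace \<Rightarrow> ('a \<times> 'a) opspace" where
  "d_interp \<theta> X0 X1 = quotient_os (F_os X0 X1)
     (\<lambda>f. (f \<theta>, nderiv (sum_space (underlying X0) (underlying X1)) f \<theta>))"

definition dOH :: "((nat \<Rightarrow> complex) \<times> (nat \<Rightarrow> complex)) opspace" where
  "dOH = d_interp (1/2) row_os col_os"

definition do_ell2 :: "((nat \<Rightarrow> complex) \<times> (nat \<Rightarrow> complex)) opspace" where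
  "do_ell2 = d_interp (1/2) (min_os ell2) (max_os ell2)"


definition completely_bounded ::
  "'a::complex_vector opspace \<Rightarrow> 'b::complex_vector opspace \<Rightarrow> ('a \<Rightarrow> 'b) \<Rightarrow> bool" where
  "completely_bounded X Y T \<longleftrightarrow> clinear_on (carrier X) T \<and> T ` carrier X \<subseteq> carrier Y \<and>
     (\<exists>K. \<forall>n. \<forall>x\<in>mats n (carrier X). mnorm Y n (\<lambda>i j. T (x i j)) \<le> K * mnorm X n x)"

definition complete_isomorphism ::
  "'a::complex_vector opspace \<Rightarrow> 'b::complex_vector opspace \<Rightarrow> ('a \<Rightarrow> 'b) \<Rightarrow> bool" where
  "complete_isomorphism X Y T \<longleftrightarrow> bij_betw T (carrier X) (carrier Y) \<and>
     completely_bounded X Y T \<and> completely_bounded Y X (inv_into (carrier X) T)"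

text \<open>
  Equivalence of extensions \<open>0 \<rightarrow> Y \<rightarrow> X \<rightarrow> Z \<rightarrow> 0\<close> with inclusion \<open>i\<close> and quotient map \<open>q\<close>, and
  \<open>0 \<rightarrow> Y' \<rightarrow> X' \<rightarrow> Z' \<rightarrow> 0\<close> with inclusion \<open>i'\<close> and quotient map \<open>q'\<close>.
\<close>

record ('y, 'x, 'z) extension =
  sub_space :: "'y opspace"
  mid_space :: "'x opspace"
  quot_space :: "'z opspace"
  incl :: "'y \<Rightarrow> 'x"
  qmap :: "'x \<Rightarrow> 'z"

definition completely_isomorphically_equivalent ::
  "('a::complex_vector, 'b::complex_vector, 'c::complex_vector) extension \<Rightarrow>
   ('d::complex_vector, 'e::complex_vector, 'f::complex_vector) extension \<Rightarrow> bool" where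
  "completely_isomorphically_equivalent E E' \<longleftrightarrow>
     (\<exists>\<alpha> \<beta> \<gamma>.
        complete_isomorphism (sub_space E) (sub_space E') \<alpha> \<and>
        complete_isomorphism (mid_space E) (mid_space E') \<beta> \<and>
        complete_isomorphism (quot_space E) (quot_space E') \<gamma> \<and>
        (\<forall>y\<in>carrier (sub_space E). \<beta> (incl E y) = incl E' (\<alpha> y)) \<and>
        (\<forall>x\<in>carrier (mid_space E). qmap E' (\<beta> x) = \<gamma> (qmap E x)))"

text \<open>
  The complete extension \<open>0 \<rightarrow> X \<rightarrow> dX \<rightarrow> X \<rightarrow> 0\<close>, where \<open>dX\<close> consists of pairs.
\<close>

definition pair_extension ::
  "'a::zero opspace \<Rightarrow> ('a \<times> 'a) opspace \<Rightarrow> ('a, 'a \<times> 'a, 'a) extension" where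
  "pair_extension X dX = \<lparr>sub_space = X, mid_space = dX, quot_space = X,
     incl = (\<lambda>y. (0, y)), qmap = fst\<rparr>"

end

theory Submission
  imports Defs "HOL-Complex_Analysis.Conformal_Mappings"
begin

text \<open>
  The two extensions are told apart by the transposition of matrices: the couple
  \<open>(min(\<ell>\<^sub>2), max(\<ell>\<^sub>2))\<close> does not see it, whereas it exchanges \<open>R\<close> and \<open>C\<close>.

  Put the first \<open>n\<close> basis vectors into one column of a matrix. The resulting \<open>x\<close> has norm \<open>1\<close>
  in \<open>M\<^sub>n(R)\<close> and \<open>\<surd>n\<close> in \<open>M\<^sub>n(C)\<close>, so \<open>f(z) = exp (- (ln n / 2) (z - 1/2)) x\<close> has the same norm
  \<open>n powr (1/4)\<close> on both boundary lines of the strip, and the pair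
  \<open>(f(1/2), f'(1/2)) = (x, - (ln n / 2) x)\<close> has norm at most \<open>n powr (1/4)\<close> in \<open>M\<^sub>n(dOH)\<close>.
  If the vectors are put into one row instead, \<open>R\<close> and \<open>C\<close> change places and the sign of the
  derivative is reversed (\<open>test_matrix_norm\<close>).

  For \<open>(min(\<ell>\<^sub>2), max(\<ell>\<^sub>2))\<close> rows and columns behave alike. Let \<open>F\<close> be an admissible function for this
  couple of norm less than \<open>n powr (1/4) M\<close>, let \<open>g\<^sub>k\<close> and \<open>y\<^sub>k\<close> be the entries of \<open>F(1/2)\<close> and \<open>F'(1/2)\<close> in
  the chosen row or column, and let \<open>v\<^sub>k\<close> be the images of the basis vectors under a bounded operator.
  The sum \<open>\<Sum>\<^sub>k \<langle>F\<^sub>k(z), v\<^sub>k\<rangle>\<close> is at most of the order of \<open>n powr (5/4)\<close> on the line where \<open>F\<close> is controlled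
  in the min norm, because each of the \<open>n\<close> terms is controlled separately, and at most of the order of
  \<open>n powr (3/4)\<close> on the line where \<open>F\<close> is controlled in the max norm, by the Cauchy--Schwarz inequality
  applied to a factorization \<open>A D B\<close> (\<open>max_norm_pairing\<close>). Multiplication by
  \<open>exp ((ln n / 2) (z - 1/2))\<close> makes both bounds of order \<open>n\<close>, and the Cauchy estimate for the derivative at \<open>1/2\<close>
  shows that \<open>\<Sum>\<^sub>k \<langle>y\<^sub>k, v\<^sub>k\<rangle> + (ln n / 2) \<Sum>\<^sub>k \<langle>g\<^sub>k, v\<^sub>k\<rangle>\<close> is of order \<open>n\<close>, with the same sign for rows and for
  columns (\<open>do_ell2_line_estimate\<close>).

  An equivalence \<open>(\<alpha>, \<beta>, \<gamma>)\<close> maps both test matrices of \<open>dOH\<close> to matrices over \<open>do(\<ell>\<^sub>2)\<close> to which this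
  applies. Both images have first components \<open>\<gamma> e\<^sub>k\<close>, and their second components differ by
  \<open>- ln n \<cdot> \<alpha> e\<^sub>k\<close>. Subtracting the two estimates, with \<open>v\<^sub>k = \<alpha> e\<^sub>k\<close>, leaves
  \<open>ln n \<cdot> \<Sum>\<^sub>k \<parallel>\<alpha> e\<^sub>k\<parallel>\<^sup>2\<close> of order \<open>n\<close> (\<open>truncated_energy_bound\<close>). As \<open>\<alpha>\<close> is bounded below, the sum is at
  least of order \<open>n\<close>, and \<open>ln n\<close> would be bounded.
\<close>

section \<open>Operator norms of finite matrices\<close>

text \<open>The sum of the moduli of the entries bounds the set of which \<^const>\<open>opnorm\<close> is the supremum, so that
  this supremum is the genuine one.\<close>

lemma norm_matrix_vector_le_sum:
  fixes A :: "'i \<Rightarrow> 'j \<Rightarrow> complex"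
  assumes "finite J" "L2_set (\<lambda>j. cmod (v j)) J \<le> 1"
  shows "L2_set (\<lambda>i. cmod (\<Sum>j\<in>J. A i j * v j)) I \<le> (\<Sum>i\<in>I. \<Sum>j\<in>J. cmod (A i j))"
proof -
  have "cmod (v j) \<le> 1" if "j \<in> J" for j
    using member_le_L2_set[OF assms(1) that, of "\<lambda>j. cmod (v j)"] assms(2) by simp
  then have "cmod (\<Sum>j\<in>J. A i j * v j) \<le> (\<Sum>j\<in>J. cmod (A i j))" for i
    by (intro order.trans[OF norm_sum] sum_mono) (simp add: norm_mult mult_left_le)
  then show ?thesis
    by (intro order.trans[OF L2_set_le_sum] sum_mono) auto
qed

lemma opnorm_upper:
  assumes "finite J" "L2_set (\<lambda>j. cmod (v j)) J \<le> 1"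
  shows "L2_set (\<lambda>i. cmod (\<Sum>j\<in>J. A i j * v j)) I \<le> opnorm I J A"
  unfolding opnorm_def
  by (intro cSUP_upper bdd_aboveI2[where M = "\<Sum>i\<in>I. \<Sum>j\<in>J. cmod (A i j)"])
     (use assms norm_matrix_vector_le_sum in auto)

lemma nonempty_of_member: "x \<in> S \<Longrightarrow> S \<noteq> {}" by blast

lemma opnorm_least:
  assumes "\<And>v. L2_set (\<lambda>j. cmod (v j)) J \<le> 1 \<Longrightarrow>
             L2_set (\<lambda>i. cmod (\<Sum>j\<in>J. A i j * v j)) I \<le> B"
  shows "opnorm I J A \<le> B"
  unfolding opnorm_def
proof (rule cSUP_least)
  have "(\<lambda>_. 0) \<in> {v. L2_set (\<lambda>j. cmod (v j)) J \<le> 1}" by (simp add: L2_set_def)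
  then show "{v. L2_set (\<lambda>j. cmod (v j)) J \<le> 1} \<noteq> {}" by (rule nonempty_of_member)
next
  fix v assume "v \<in> {v. L2_set (\<lambda>j. cmod (v j)) J \<le> 1}"
  then show "L2_set (\<lambda>i. cmod (\<Sum>j\<in>J. A i j * v j)) I \<le> B" by (intro assms) simp
qed

lemma opnorm_le_sum:
  "finite J \<Longrightarrow> opnorm I J A \<le> (\<Sum>i\<in>I. \<Sum>j\<in>J. cmod (A i j))"
  by (intro opnorm_least norm_matrix_vector_le_sum)

lemma opnorm_nonneg: "finite J \<Longrightarrow> 0 \<le> opnorm I J A"
  using opnorm_upper[of J "\<lambda>_. 0" A I] by (simp add: L2_set_def)

lemma column_le_opnorm:
  assumes "finite J" "j \<in> J"
  shows "L2_set (\<lambda>i. cmod (A i j)) I \<le> opnorm I J A"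
proof -
  let ?v = "\<lambda>j'. if j' = j then 1 else 0 :: complex"
  have "L2_set (\<lambda>j. cmod (?v j)) J = 1"
    using assms by (simp add: L2_set_def if_distrib[of "\<lambda>x. (cmod x)\<^sup>2"] cong: if_cong)
  moreover have "(\<Sum>j\<in>J. A i j * ?v j) = A i j" for i
    using assms by (simp add: if_distrib[of "\<lambda>x. A i _ * x"] cong: if_cong)
  ultimately show ?thesis
    using opnorm_upper[OF assms(1), of ?v A I] by simp
qed

text \<open>A row is detected by the unit vector proportional to its conjugate.\<close>

lemma row_le_opnorm:
  assumes "finite I" "finite J" "i \<in> I"
  shows "L2_set (\<lambda>j. cmod (A i j)) J \<le> opnorm I J A"
proof (cases "L2_set (\<lambda>j. cmod (A i j)) J = 0")
  case True
  then show ?thesis using opnorm_nonneg[OF assms(2)] by simp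
next
  case False
  define s where "s = L2_set (\<lambda>j. cmod (A i j)) J"
  have s: "s > 0" using False by (simp add: s_def less_le)
  have s2: "s\<^sup>2 = (\<Sum>j\<in>J. (cmod (A i j))\<^sup>2)"
    by (simp add: s_def L2_set_def sum_nonneg)
  let ?v = "\<lambda>j. cnj (A i j) / complex_of_real s"
  have "L2_set (\<lambda>j. cmod (?v j)) J = L2_set (\<lambda>j. cmod (A i j) * (1 / s)) J"
    using s by (simp add: norm_divide)
  also have "\<dots> = s * (1 / s)"
    using s by (subst L2_set_left_distrib[symmetric]) (simp_all add: s_def)
  finally have v: "L2_set (\<lambda>j. cmod (?v j)) J \<le> 1" using s by simp
  have "(\<Sum>j\<in>J. A i j * ?v j) = (\<Sum>j\<in>J. complex_of_real ((cmod (A i j))\<^sup>2)) / s"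
    by (simp only: sum_divide_distrib times_divide_eq_right) (simp only: complex_norm_square)
  also have "\<dots> = complex_of_real (s\<^sup>2) / s" by (simp add: s2)
  also have "\<dots> = s" using s by (simp add: power2_eq_square)
  finally have "s = cmod (\<Sum>j\<in>J. A i j * ?v j)" using s by simp
  also have "\<dots> \<le> L2_set (\<lambda>i. cmod (\<Sum>j\<in>J. A i j * ?v j)) I"
    by (rule member_le_L2_set) (use assms in auto)
  also have "\<dots> \<le> opnorm I J A" by (rule opnorm_upper[OF assms(2) v])
  finally show ?thesis by (simp add: s_def)
qed

lemma entry_le_opnorm:
  assumes "finite I" "finite J" "i \<in> I" "j \<in> J"
  shows "cmod (A i j) \<le> opnorm I J A"
  using member_le_L2_set[OF assms(1,3), of "\<lambda>i. cmod (A i j)"] column_le_opnorm[OF assms(2,4), of A I]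
  by simp

lemma opnorm_singleton: "opnorm {i} {j} A = cmod (A i j)"
  using entry_le_opnorm[of "{i}" "{j}" i j A] opnorm_le_sum[of "{j}" "{i}" A] by simp

lemma opnorm_diagonal_le:
  assumes "finite I" "0 \<le> B" "\<And>i j. i \<in> I \<Longrightarrow> j \<in> I \<Longrightarrow> i \<noteq> j \<Longrightarrow> A i j = 0"
    "\<And>i. i \<in> I \<Longrightarrow> cmod (A i i) \<le> B"
  shows "opnorm I I A \<le> B"
proof (rule opnorm_least)
  fix v assume v: "L2_set (\<lambda>j. cmod (v j)) I \<le> 1"
  have "(\<Sum>j\<in>I. A i j * v j) = A i i * v i" if "i \<in> I" for i
  proof -
    have "(\<Sum>j\<in>I. A i j * v j) = (\<Sum>j\<in>I. if j = i then A i i * v i else 0)"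
      by (rule sum.cong) (use that assms(3) in auto)
    then show ?thesis using that assms(1) by simp
  qed
  then have "L2_set (\<lambda>i. cmod (\<Sum>j\<in>I. A i j * v j)) I \<le> L2_set (\<lambda>i. B * cmod (v i)) I"
    by (intro L2_set_mono) (auto simp: norm_mult intro: mult_right_mono assms(4))
  also have "\<dots> = B * L2_set (\<lambda>i. cmod (v i)) I"
    by (rule L2_set_right_distrib[symmetric]) fact
  also have "\<dots> \<le> B" using v assms(2) by (simp add: mult_left_le)
  finally show "L2_set (\<lambda>i. cmod (\<Sum>j\<in>I. A i j * v j)) I \<le> B" .
qed

text \<open>The inequality \<open>2 |a b| \<le> |a|\<^sup>2 + |b|\<^sup>2\<close> gives both the convergence of the series and the bound.\<close>

lemma norm_suminf_le_half_squares:
  fixes a b :: "nat \<Rightarrow> 'l \<Rightarrow> complex"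
  assumes "\<And>l. l \<in> L \<Longrightarrow> summable (\<lambda>k. (cmod (a k l))\<^sup>2)" "\<And>l. l \<in> L \<Longrightarrow> summable (\<lambda>k. (cmod (b k l))\<^sup>2)"
  shows "cmod (\<Sum>k. \<Sum>l\<in>L. a k l * cnj (b k l))
    \<le> (\<Sum>l\<in>L. ((\<Sum>k. (cmod (a k l))\<^sup>2) + (\<Sum>k. (cmod (b k l))\<^sup>2)) / 2)"
proof -
  let ?g = "\<lambda>k. \<Sum>l\<in>L. ((cmod (a k l))\<^sup>2 + (cmod (b k l))\<^sup>2) / 2"
  have le: "cmod (\<Sum>l\<in>L. a k l * cnj (b k l)) \<le> ?g k" for k
  proof (intro order.trans[OF norm_sum] sum_mono)
    fix l
    show "cmod (a k l * cnj (b k l)) \<le> ((cmod (a k l))\<^sup>2 + (cmod (b k l))\<^sup>2) / 2"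
      using sum_squares_bound[of "cmod (a k l)" "cmod (b k l)"] by (simp add: norm_mult)
  qed
  have sg: "?g sums (\<Sum>l\<in>L. ((\<Sum>k. (cmod (a k l))\<^sup>2) + (\<Sum>k. (cmod (b k l))\<^sup>2)) / 2)"
    by (intro sums_sum sums_divide sums_add summable_sums assms)
  have "summable (\<lambda>k. cmod (\<Sum>l\<in>L. a k l * cnj (b k l)))"
    by (rule summable_comparison_test'[OF sums_summable[OF sg], of 0]) (use le in auto)
  then have "cmod (\<Sum>k. \<Sum>l\<in>L. a k l * cnj (b k l)) \<le> (\<Sum>k. cmod (\<Sum>l\<in>L. a k l * cnj (b k l)))"
    by (rule summable_norm)
  also have "\<dots> \<le> (\<Sum>k. ?g k)"
    by (intro suminf_le le sums_summable[OF sg]) fact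
  finally show ?thesis using sums_unique[OF sg] by simp
qed

section \<open>The sequence space\<close>

abbreviation l2 :: "(nat \<Rightarrow> complex) set" where "l2 \<equiv> ncarrier ell2"
abbreviation l2norm :: "(nat \<Rightarrow> complex) \<Rightarrow> real" where "l2norm \<equiv> nnorm ell2"

lemma l2_iff: "x \<in> l2 \<longleftrightarrow> summable (\<lambda>k. (cmod (x k))\<^sup>2)"
  by (simp add: ell2_def)

lemma l2norm_eq: "l2norm x = sqrt (\<Sum>k. (cmod (x k))\<^sup>2)"
  by (simp add: ell2_def)

lemma l2norm_nonneg: "x \<in> l2 \<Longrightarrow> 0 \<le> l2norm x"
  by (simp add: l2_iff l2norm_eq suminf_nonneg)

lemma l2norm_power2: "x \<in> l2 \<Longrightarrow> (l2norm x)\<^sup>2 = (\<Sum>k. (cmod (x k))\<^sup>2)"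
  by (simp add: l2_iff l2norm_eq suminf_nonneg)

lemma truncation_le_l2norm: "x \<in> l2 \<Longrightarrow> L2_set (\<lambda>m. cmod (x m)) {..<N} \<le> l2norm x"
  unfolding L2_set_def l2norm_eq l2_iff by (intro real_sqrt_le_mono sum_le_suminf) auto

lemma coordinate_le_l2norm: "x \<in> l2 \<Longrightarrow> cmod (x m) \<le> l2norm x"
  using member_le_L2_set[of "{..<Suc m}" m "\<lambda>m. cmod (x m)"] truncation_le_l2norm[of x "Suc m"]
  by simp

text \<open>Square summability and norm bounds are bounds on the truncations, which reduces the
  Hilbert space facts to the finite sums \<^const>\<open>L2_set\<close>.\<close>

lemma l2_by_truncations:
  assumes "\<And>N. L2_set (\<lambda>m. cmod (x m)) {..<N} \<le> B"
  shows "x \<in> l2" and "l2norm x \<le> B"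
proof -
  have B: "0 \<le> B" using assms[of 0] by simp
  have le: "(\<Sum>m<N. (cmod (x m))\<^sup>2) \<le> B\<^sup>2" for N
    using assms[of N] unfolding L2_set_def by (rule sqrt_le_D)
  have "summable (\<lambda>k. (cmod (x k))\<^sup>2)"
    by (rule bounded_imp_summable[where B = "B\<^sup>2"]) (use le[of "Suc _"] in \<open>auto simp: lessThan_Suc_atMost\<close>)
  then show "x \<in> l2" by (simp add: l2_iff)
  then have "(\<Sum>k. (cmod (x k))\<^sup>2) \<le> B\<^sup>2"
    by (intro suminf_le_const le) (simp add: l2_iff)
  then show "l2norm x \<le> B" unfolding l2norm_eq using B by (simp add: real_le_lsqrt)
qed

lemma l2_add: "x \<in> l2 \<Longrightarrow> y \<in> l2 \<Longrightarrow> x + y \<in> l2"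
  and l2norm_triangle: "x \<in> l2 \<Longrightarrow> y \<in> l2 \<Longrightarrow> l2norm (x + y) \<le> l2norm x + l2norm y"
proof -
  have "L2_set (\<lambda>m. cmod ((x + y) m)) {..<N} \<le> l2norm x + l2norm y" if "x \<in> l2" "y \<in> l2" for N
  proof -
    have "L2_set (\<lambda>m. cmod ((x + y) m)) {..<N} \<le> L2_set (\<lambda>m. cmod (x m) + cmod (y m)) {..<N}"
      by (intro L2_set_mono) (auto intro: norm_triangle_ineq)
    also have "\<dots> \<le> L2_set (\<lambda>m. cmod (x m)) {..<N} + L2_set (\<lambda>m. cmod (y m)) {..<N}"
      by (rule L2_set_triangle_ineq)
    also have "\<dots> \<le> l2norm x + l2norm y" using that by (intro add_mono truncation_le_l2norm)
    finally show ?thesis .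
  qed
  from l2_by_truncations[where x = "x + y", OF this]
  show "x \<in> l2 \<Longrightarrow> y \<in> l2 \<Longrightarrow> x + y \<in> l2" "x \<in> l2 \<Longrightarrow> y \<in> l2 \<Longrightarrow> l2norm (x + y) \<le> l2norm x + l2norm y"
    by blast+
qed

lemma l2_scale: "x \<in> l2 \<Longrightarrow> c *\<^sub>C x \<in> l2"
  and l2norm_scale: "x \<in> l2 \<Longrightarrow> l2norm (c *\<^sub>C x) = cmod c * l2norm x"
  by (auto simp: l2_iff l2norm_eq scaleC_fun_def scaleC_complex_def norm_mult power_mult_distrib
      suminf_mult real_sqrt_mult)

lemma l2_0: "0 \<in> l2" and l2norm_0: "l2norm 0 = 0"
  by (auto simp: l2_iff l2norm_eq)

lemma l2_diff: "x \<in> l2 \<Longrightarrow> y \<in> l2 \<Longrightarrow> x - y \<in> l2"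
  using l2_add[of x "(-1) *\<^sub>C y"] l2_scale[of y "-1"] 
  by (simp add: scaleC_fun_def scaleC_complex_def fun_diff_def plus_fun_def)

lemma l2_sum:
  assumes "finite S" "\<And>k. k \<in> S \<Longrightarrow> d k \<in> l2"
  shows "(\<Sum>k\<in>S. c k *\<^sub>C d k) \<in> l2 \<and>
         l2norm (\<Sum>k\<in>S. c k *\<^sub>C d k) \<le> (\<Sum>k\<in>S. cmod (c k) * l2norm (d k))"
  using assms
proof (induction S rule: finite_induct)
  case empty
  have "(\<Sum>k\<in>{}. c k *\<^sub>C d k) = 0" by (rule sum.empty)
  with l2_0 l2norm_0 show ?case by (metis order_refl sum.empty)
next
  case (insert k S)
  define s where "s = (\<Sum>k\<in>S. c k *\<^sub>C d k)"
  have eq: "(\<Sum>k\<in>insert k S. c k *\<^sub>C d k) = c k *\<^sub>C d k + s"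
    unfolding s_def by (rule sum.insert) fact+
  have s: "s \<in> l2" "l2norm s \<le> (\<Sum>k\<in>S. cmod (c k) * l2norm (d k))"
    using insert by (auto simp: s_def)
  have d: "d k \<in> l2" using insert by simp
  have "l2norm (c k *\<^sub>C d k + s) \<le> cmod (c k) * l2norm (d k) + l2norm s"
    using l2norm_triangle[OF l2_scale[OF d] s(1), of "c k"] by (simp only: l2norm_scale[OF d])
  also have "\<dots> \<le> (\<Sum>k\<in>insert k S. cmod (c k) * l2norm (d k))"
    using s(2) by (subst sum.insert[OF insert(1,2)]) (rule add_left_mono)
  finally show ?case unfolding eq using l2_add[OF l2_scale[OF d] s(1)] by blast
qed

lemma scaleC_0: "0 *\<^sub>C x = (0 :: 'a :: complex_vector)"
  using scaleC_add_left[of 0 0 x] by simp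

lemma clinear_on_sum:
  assumes "clinear_on l2 T" "finite S" "\<And>k. k \<in> S \<Longrightarrow> d k \<in> l2"
  shows "T (\<Sum>k\<in>S. c k *\<^sub>C d k) = (\<Sum>k\<in>S. c k *\<^sub>C T (d k))"
  using assms(2,3)
proof (induction S rule: finite_induct)
  case empty
  have "T (0 *\<^sub>C 0) = 0 *\<^sub>C T 0" using assms(1) l2_0 unfolding clinear_on_def by blast
  then show ?case by (simp only: scaleC_0 sum.empty)
next
  case (insert k S)
  define s where "s = (\<Sum>k\<in>S. c k *\<^sub>C d k)"
  have eq: "(\<Sum>k\<in>insert k S. c k *\<^sub>C d k) = c k *\<^sub>C d k + s"
    unfolding s_def by (rule sum.insert) fact+
  have d: "d k \<in> l2" and s: "s \<in> l2"
    using insert l2_sum[of S d c] by (auto simp: s_def)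
  have "T (c k *\<^sub>C d k + s) = T (c k *\<^sub>C d k) + T s"
    using assms(1) l2_scale[OF d] s unfolding clinear_on_def by blast
  also have "T (c k *\<^sub>C d k) = c k *\<^sub>C T (d k)"
    using assms(1) d unfolding clinear_on_def by blast
  also have "T s = (\<Sum>k\<in>S. c k *\<^sub>C T (d k))"
    using insert by (simp add: s_def)
  finally show ?case unfolding eq sum.insert[OF insert(1,2)] .
qed

definition unit_vec :: "nat \<Rightarrow> nat \<Rightarrow> complex" where
  "unit_vec k = (\<lambda>m. if m = k then 1 else 0)"

lemma unit_vec_l2: "unit_vec k \<in> l2" and l2norm_unit_vec: "l2norm (unit_vec k) = 1"
proof -
  have "(\<lambda>m. (cmod (unit_vec k m))\<^sup>2) sums (\<Sum>m\<in>{k}. (cmod (unit_vec k m))\<^sup>2)"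
    by (rule sums_finite) (auto simp: unit_vec_def)
  then show "unit_vec k \<in> l2" "l2norm (unit_vec k) = 1"
    by (auto simp: l2_iff l2norm_eq sums_iff unit_vec_def)
qed

lemma l2norm_sum_unit_vec:
  "l2norm (\<Sum>k<n. c k *\<^sub>C unit_vec k) = L2_set (\<lambda>k. cmod (c k)) {..<n}"
proof -
  have eq: "(\<Sum>k<n. c k *\<^sub>C unit_vec k) m = (if m < n then c m else 0)" for m
  proof -
    have "(\<Sum>k<n. c k *\<^sub>C unit_vec k) m = (\<Sum>k<n. if m = k then c k else 0)"
      by (induction n) (auto simp: scaleC_fun_def scaleC_complex_def unit_vec_def)
    also have "\<dots> = (if m < n then c m else 0)" by simp
    finally show ?thesis .
  qed
  have "(\<Sum>m. (cmod ((\<Sum>k<n. c k *\<^sub>C unit_vec k) m))\<^sup>2)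
      = (\<Sum>m<n. (cmod ((\<Sum>k<n. c k *\<^sub>C unit_vec k) m))\<^sup>2)"
    by (rule suminf_finite) (auto simp: eq)
  then show ?thesis by (simp add: l2norm_eq L2_set_def eq)
qed

section \<open>Bounded analytic functions on the strip\<close>

lemma open_strip_subset_interior: "{z. 0 < Re z \<and> Re z < 1} \<subseteq> interior strip"
proof (rule interior_maximal)
  have "{z. 0 < Re z \<and> Re z < 1} = {z. 0 < Re z} \<inter> {z. Re z < 1}" by auto
  then show "open {z. 0 < Re z \<and> Re z < 1}"
    by (simp add: open_Int open_halfspace_Re_gt open_halfspace_Re_lt)
qed (auto simp: strip_def)

lemma cmod_exp_square: "cmod (exp (complex_of_real e * z\<^sup>2)) = exp (e * ((Re z)\<^sup>2 - (Im z)\<^sup>2))"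
  by (simp add: power2_eq_square)

text \<open>A Phragmen--Lindelof principle. The factor \<open>exp (e z\<^sup>2)\<close> makes the bounded function decay along the
  strip, so the maximum modulus principle applies on a rectangle; then \<open>e\<close> tends to \<open>0\<close>.\<close>

lemma strip_maximum_modulus:
  assumes cont: "continuous_on strip h" and hol: "h holomorphic_on interior strip"
    and bdd: "\<And>z. z \<in> strip \<Longrightarrow> cmod (h z) \<le> B"
    and bdry: "\<And>z. Re z = 0 \<or> Re z = 1 \<Longrightarrow> cmod (h z) \<le> C"
    and z: "z \<in> strip"
  shows "cmod (h z) \<le> C"
proof -
  have C: "0 \<le> C" using bdry[of 0] norm_ge_zero[of "h 0"] by (simp del: norm_ge_zero)
  have B: "0 \<le> B" using bdd[OF z] norm_ge_zero[of "h z"] by linarith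
  have bound: "cmod (h z) * exp (e * ((Re z)\<^sup>2 - (Im z)\<^sup>2)) \<le> (C + e) * exp e" if e: "e > 0" for e :: real
  proof -
    \<comment> \<open>The height is such that \<open>exp (- e T\<^sup>2)\<close> brings the global bound \<open>B\<close> below \<open>e\<close>.\<close>
    define T where "T = max \<bar>Im z\<bar> (sqrt (B / e\<^sup>2))"
    define S where "S = cbox (Complex 0 (- T)) (Complex 1 T)"
    have T: "\<bar>Im z\<bar> \<le> T" "0 \<le> T" by (auto simp: T_def)
    have "B / e\<^sup>2 \<le> T\<^sup>2"
      using real_sqrt_le_iff[of "B / e\<^sup>2" "T\<^sup>2"] T(2) by (simp add: T_def)
    then have "B / e \<le> e * T\<^sup>2" using e by (simp add: field_simps power2_eq_square)
    also have "\<dots> \<le> exp (e * T\<^sup>2)" using exp_ge_add_one_self[of "e * T\<^sup>2"] by linarith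
    finally have T2: "B * exp (- (e * T\<^sup>2)) \<le> e"
      using e by (simp add: exp_minus field_simps)
    have sub: "S \<subseteq> strip" by (auto simp: S_def strip_def in_cbox_complex_iff)
    define g where "g = (\<lambda>w. h w * exp (complex_of_real e * w\<^sup>2))"
    have "cmod (g z) \<le> (C + e) * exp e"
    proof (rule maximum_modulus_frontier[of g S])
      show "g holomorphic_on interior S"
        unfolding g_def by (intro holomorphic_intros holomorphic_on_subset[OF hol] interior_mono sub)
      show "continuous_on (closure S) g"
        using sub unfolding g_def S_def closure_cbox
        by (intro continuous_intros continuous_on_subset[OF cont]) 
      show "bounded S" by (simp add: S_def)
      show "z \<in> S" using z T by (auto simp: S_def strip_def in_cbox_complex_iff)
      fix w assume "w \<in> frontier S"
      then have w: "w \<in> S" and "w \<notin> box (Complex 0 (- T)) (Complex 1 T)"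
        by (auto simp: S_def frontier_cbox)
      then consider "Re w = 0 \<or> Re w = 1" | "\<bar>Im w\<bar> = T"
        by (auto simp: S_def in_cbox_complex_iff in_box_complex_iff)
      then show "cmod (g w) \<le> (C + e) * exp e"
      proof cases
        case 1
        then have "e * ((Re w)\<^sup>2 - (Im w)\<^sup>2) \<le> e" using e by (auto simp: algebra_simps)
        then have "cmod (g w) \<le> C * exp e"
          unfolding g_def norm_mult cmod_exp_square
          by (intro mult_mono bdry 1 C) auto
        also have "\<dots> \<le> (C + e) * exp e" using e by simp
        finally show ?thesis .
      next
        case 2
        have "(Re w)\<^sup>2 \<le> 1"
          using w by (auto simp: S_def in_cbox_complex_iff intro: power_le_one)
        moreover have "(Im w)\<^sup>2 = T\<^sup>2" using 2 by (metis power2_abs)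
        ultimately have "e * ((Re w)\<^sup>2 - (Im w)\<^sup>2) \<le> e * (1 - T\<^sup>2)"
          using e by (intro mult_left_mono) auto
        then have "cmod (g w) \<le> B * exp (e * (1 - T\<^sup>2))"
          unfolding g_def norm_mult cmod_exp_square
          using w sub B by (intro mult_mono bdd) auto
        also have "\<dots> = B * exp (- (e * T\<^sup>2)) * exp e"
          by (simp add: algebra_simps flip: exp_add)
        also have "\<dots> \<le> e * exp e" using T2 by (intro mult_right_mono) auto
        also have "\<dots> \<le> (C + e) * exp e" using C by simp
        finally show ?thesis .
      qed
    qed
    then show ?thesis unfolding g_def norm_mult cmod_exp_square .
  qed
  have "((\<lambda>e. cmod (h z) * exp (e * ((Re z)\<^sup>2 - (Im z)\<^sup>2))) \<longlongrightarrow>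
      cmod (h z) * exp (0 * ((Re z)\<^sup>2 - (Im z)\<^sup>2))) (at_right 0)"
    by (intro tendsto_intros)
  moreover have "((\<lambda>e. (C + e) * exp e) \<longlongrightarrow> (C + 0) * exp 0) (at_right (0::real))"
    by (intro tendsto_intros)
  moreover have "\<forall>\<^sub>F e in at_right (0::real).
      cmod (h z) * exp (e * ((Re z)\<^sup>2 - (Im z)\<^sup>2)) \<le> (C + e) * exp e"
    using eventually_at_right_less[of "0::real"] by eventually_elim (rule bound)
  ultimately have "cmod (h z) * exp (0 * ((Re z)\<^sup>2 - (Im z)\<^sup>2)) \<le> (C + 0) * exp 0"
    by (intro tendsto_le[of "at_right (0::real)"]) auto
  then show ?thesis by simp
qed

text \<open>The disc of radius \<open>1/2\<close> about \<open>1/2\<close> lies in the strip; this is the Cauchy estimate on it.\<close>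

lemma strip_derivative_bound:
  assumes cont: "continuous_on strip h" and hol: "h holomorphic_on interior strip"
    and bdd: "\<And>z. z \<in> strip \<Longrightarrow> cmod (h z) \<le> B"
    and bdry: "\<And>z. Re z = 0 \<or> Re z = 1 \<Longrightarrow> cmod (h z) \<le> C"
    and d: "(h has_field_derivative d) (at (1/2))"
  shows "cmod d \<le> 2 * C"
proof -
  have re: "\<bar>Re z - 1/2\<bar> \<le> dist (1/2) z" for z
    using abs_Re_le_cmod[of "1/2 - z"] by (simp add: dist_norm abs_minus_commute)
  have 1: "ball (1/2) (1/2) \<subseteq> interior strip"
  proof (rule order.trans[OF _ open_strip_subset_interior], rule subsetI)
    fix z :: complex assume "z \<in> ball (1/2) (1/2)"
    then show "z \<in> {z. 0 < Re z \<and> Re z < 1}" using re[of z] by auto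
  qed
  have 2: "cball (1/2) (1/2) \<subseteq> strip"
  proof
    fix z :: complex assume "z \<in> cball (1/2) (1/2)"
    then show "z \<in> strip" using re[of z] by (auto simp: strip_def)
  qed
  have "cmod ((deriv ^^ 1) h (1/2)) \<le> fact 1 * C / (1/2) ^ 1"
  proof (rule Cauchy_inequality)
    show "h holomorphic_on ball (1/2) (1/2)" by (rule holomorphic_on_subset[OF hol 1])
    show "continuous_on (cball (1/2) (1/2)) h" by (rule continuous_on_subset[OF cont 2])
    fix z assume "cmod (1/2 - z) = 1/2"
    then have "z \<in> strip" using 2 by (auto simp: dist_norm)
    then show "cmod (h z) \<le> C" using strip_maximum_modulus[OF cont hol bdd bdry] by blast
  qed auto
  then show ?thesis using DERIV_imp_deriv[OF d] by simp
qed

section \<open>Coordinates of functions with values in a couple\<close>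

text \<open>The lower bound makes limits and derivatives in the norm pass to coordinates, so that complex
  analysis for scalar functions applies to functions with values in the sum of a couple.\<close>

definition dominates_coordinates :: "(nat \<Rightarrow> complex) nspace \<Rightarrow> bool" where
  "dominates_coordinates X \<longleftrightarrow> ncarrier X = l2 \<and> (\<forall>x\<in>l2. \<forall>m. cmod (x m) \<le> nnorm X x)"

lemma dominates_coordinates_sum_space:
  assumes "dominates_coordinates X0" "dominates_coordinates X1"
  shows "dominates_coordinates (sum_space X0 X1)"
proof -
  have c: "ncarrier X0 = l2" "ncarrier X1 = l2"
    using assms by (auto simp: dominates_coordinates_def)
  have split: "\<exists>x0\<in>l2. \<exists>x1\<in>l2. x = x0 + x1" if "x \<in> l2" for x
    using that l2_0 by (intro bexI[of _ x] bexI[of _ 0]) auto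
  have carrier: "ncarrier (sum_space X0 X1) = l2"
  proof (intro set_eqI iffI)
    fix x assume "x \<in> l2"
    from split[OF this] show "x \<in> ncarrier (sum_space X0 X1)"
      unfolding sum_space_def nspace.simps c by blast
  next
    fix x assume "x \<in> ncarrier (sum_space X0 X1)"
    then show "x \<in> l2" unfolding sum_space_def nspace.simps c using l2_add by blast
  qed
  have "cmod (x m) \<le> nnorm (sum_space X0 X1) x" if x: "x \<in> l2" for x m
    unfolding sum_space_def nspace.simps c
  proof (rule cInf_greatest)
    show "{nnorm X0 x0 + nnorm X1 x1 |x0 x1. x0 \<in> l2 \<and> x1 \<in> l2 \<and> x = x0 + x1} \<noteq> {}"
      using split[OF x] by blast
    fix r assume "r \<in> {nnorm X0 x0 + nnorm X1 x1 |x0 x1. x0 \<in> l2 \<and> x1 \<in> l2 \<and> x = x0 + x1}"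
    then obtain x0 x1 where r: "r = nnorm X0 x0 + nnorm X1 x1" "x0 \<in> l2" "x1 \<in> l2" "x = x0 + x1"
      by blast
    have "cmod (x m) \<le> cmod (x0 m) + cmod (x1 m)" by (simp add: r norm_triangle_ineq)
    also have "\<dots> \<le> r" using assms r by (auto simp: dominates_coordinates_def intro!: add_mono)
    finally show "cmod (x m) \<le> r" .
  qed
  with carrier show ?thesis by (simp add: dominates_coordinates_def)
qed

lemma has_nderiv_coordinate:
  assumes X: "dominates_coordinates X" and f: "\<And>w. w \<in> strip \<Longrightarrow> f w \<in> l2"
    and z: "z \<in> interior strip" and d: "has_nderiv X f d z"
  shows "((\<lambda>w. f w m) has_field_derivative d m) (at z)"
  unfolding has_field_derivative_iff
proof (rule LIM_zero_cancel, rule Lim_null_comparison)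
  show "((\<lambda>w. nnorm X ((1 / (w - z)) *\<^sub>C (f w - f z) - d)) \<longlongrightarrow> 0) (at z)"
    using d by (simp add: has_nderiv_def)
  have dl: "d \<in> l2" using d X by (simp add: has_nderiv_def dominates_coordinates_def)
  have "\<forall>\<^sub>F w in at z. w \<in> interior strip"
    using eventually_at_in_open'[of "interior strip" z] z by simp
  then show "\<forall>\<^sub>F w in at z. norm ((f w m - f z m) / (w - z) - d m)
      \<le> nnorm X ((1 / (w - z)) *\<^sub>C (f w - f z) - d)"
  proof eventually_elim
    case (elim w)
    then have "w \<in> strip" "z \<in> strip" using z interior_subset by auto
    then have "(1 / (w - z)) *\<^sub>C (f w - f z) - d \<in> l2"
      by (intro l2_diff l2_scale f dl)
    then have "cmod (((1 / (w - z)) *\<^sub>C (f w - f z) - d) m)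
        \<le> nnorm X ((1 / (w - z)) *\<^sub>C (f w - f z) - d)"
      using X unfolding dominates_coordinates_def by blast
    then show ?case by (simp add: scaleC_fun_def scaleC_complex_def)
  qed
qed

lemma nderiv_eqI:
  assumes "dominates_coordinates X" "\<And>w. w \<in> strip \<Longrightarrow> f w \<in> l2"
    "z \<in> interior strip" "has_nderiv X f d z"
  shows "nderiv X f z = d"
  unfolding nderiv_def
proof (rule the_equality)
  fix d' assume d': "has_nderiv X f d' z"
  show "d' = d"
    using DERIV_unique[OF has_nderiv_coordinate[OF assms(1-3) d'] has_nderiv_coordinate[OF assms]]
    by (simp add: fun_eq_iff)
qed fact

text \<open>What a member of \<^const>\<open>calF\<close> gives for scalar complex analysis, and why \<^const>\<open>nderiv\<close> is its
  derivative: derivatives exist by definition and are unique because their coordinates are.\<close>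

lemma calF_coordinate:
  assumes X: "dominates_coordinates X0" "dominates_coordinates X1" and f: "f \<in> calF X0 X1"
  shows "\<And>z. z \<in> strip \<Longrightarrow> f z \<in> l2"
    and "\<exists>B. \<forall>z\<in>strip. \<forall>m. cmod (f z m) \<le> B"
    and "\<And>m. continuous_on strip (\<lambda>z. f z m)"
    and "\<And>z m. z \<in> interior strip \<Longrightarrow>
      ((\<lambda>z. f z m) has_field_derivative nderiv (sum_space X0 X1) f z m) (at z)"
proof -
  let ?S = "sum_space X0 X1"
  have S: "dominates_coordinates ?S" by (rule dominates_coordinates_sum_space[OF X])
  then have le: "cmod (x m) \<le> nnorm ?S x" and car: "ncarrier ?S = l2" if "x \<in> l2" for x m
    using that by (auto simp: dominates_coordinates_def)
  show mem: "\<And>z. z \<in> strip \<Longrightarrow> f z \<in> l2"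
    using f S by (auto simp: calF_def dominates_coordinates_def)
  obtain B where B: "\<forall>z\<in>strip. nnorm ?S (f z) \<le> B" using f by (auto simp: calF_def)
  show "\<exists>B. \<forall>z\<in>strip. \<forall>m. cmod (f z m) \<le> B"
  proof (intro exI ballI allI)
    fix z m assume z: "z \<in> strip"
    show "cmod (f z m) \<le> B" by (rule order.trans[OF le[OF mem[OF z]]]) (use B z in simp)
  qed
  show "continuous_on strip (\<lambda>z. f z m)" for m
    unfolding continuous_on_def
  proof (rule ballI, rule LIM_zero_cancel, rule Lim_null_comparison)
    fix z assume z: "z \<in> strip"
    then show "((\<lambda>w. nnorm ?S (f w - f z)) \<longlongrightarrow> 0) (at z within strip)"
      using f by (simp add: calF_def)
    show "\<forall>\<^sub>F w in at z within strip. norm (f w m - f z m) \<le> nnorm ?S (f w - f z)"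
      unfolding eventually_at_topological
      using le[OF l2_diff[OF mem mem[OF z]]] by (intro exI[of _ UNIV]) auto
  qed
  show "((\<lambda>z. f z m) has_field_derivative nderiv ?S f z m) (at z)" if z: "z \<in> interior strip" for z m
  proof -
    obtain d where d: "has_nderiv ?S f d z" using f z by (auto simp: calF_def)
    show ?thesis
      using has_nderiv_coordinate[OF S mem z d] nderiv_eqI[OF S mem z d] by simp
  qed
qed

section \<open>Exponential functions with values in sequences\<close>

lemma l2_self_inner:
  "x \<in> l2 \<Longrightarrow> (\<Sum>k. x k * cnj (x k)) = complex_of_real ((l2norm x)\<^sup>2)"
  by (simp only: l2norm_power2 suminf_of_real l2_iff flip: complex_norm_square)

lemma underlying_row_os:
  shows "ncarrier (underlying row_os) = l2" and "x \<in> l2 \<Longrightarrow> nnorm (underlying row_os) x = l2norm x"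
  by (simp_all add: underlying_def row_os_def lessThan_Suc opnorm_singleton l2_self_inner norm_power l2norm_nonneg)

lemma underlying_col_os:
  shows "ncarrier (underlying col_os) = l2" and "x \<in> l2 \<Longrightarrow> nnorm (underlying col_os) x = l2norm x"
  by (simp_all add: underlying_def col_os_def lessThan_Suc opnorm_singleton l2_self_inner norm_power l2norm_nonneg
       mult.commute[of "cnj _"])

text \<open>The first matrix level of \<^const>\<open>OH\<close> is \<open>\<ell>\<^sub>2\<close>, so complete boundedness gives bounds in the norm of \<open>\<ell>\<^sub>2\<close>.\<close>

lemma mnorm_OH_1:
  "x 0 0 \<in> l2 \<Longrightarrow> mnorm OH 1 x = l2norm (x 0 0)"
proof -
  assume x: "x 0 0 \<in> l2"
  have "{..<1} \<times> {..<1} = {(0::nat, 0::nat)}" by auto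
  then show ?thesis
    by (simp add: OH_def opnorm_singleton l2_self_inner[OF x] norm_power l2norm_nonneg[OF x])
qed

text \<open>The modulus of the scalar factor depends on \<open>Re z\<close> only and is \<open>exp (- \<mu> / 2)\<close> and \<open>exp (\<mu> / 2)\<close> on the
  two boundary lines. The choice of \<open>\<mu>\<close> thus balances two different norms of one matrix.\<close>

definition exp_function :: "real \<Rightarrow> (nat \<Rightarrow> complex) \<Rightarrow> complex \<Rightarrow> nat \<Rightarrow> complex" where
  "exp_function \<mu> v = (\<lambda>z. exp (complex_of_real \<mu> * (z - 1/2)) *\<^sub>C v)"

lemma exp_function_half: "exp_function \<mu> v (1/2) = v"
  by (simp add: exp_function_def scaleC_one)

lemma exp_function_0: "exp_function \<mu> 0 = 0"
  by (simp add: exp_function_def fun_eq_iff scaleC_fun_def scaleC_complex_def)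

lemma half_interior_strip: "1/2 \<in> interior strip"
  using open_strip_subset_interior by auto

lemma scaleC_diff_left: "(a - b) *\<^sub>C (x :: nat \<Rightarrow> complex) = a *\<^sub>C x - b *\<^sub>C x"
  by (simp add: scaleC_fun_def scaleC_complex_def fun_eq_iff algebra_simps)

text \<open>The couple \<open>(R, C)\<close> has \<open>\<ell>\<^sub>2\<close> as the underlying Banach space at both ends, which is the
  situation considered here.\<close>

context
  fixes X0 X1 :: "(nat \<Rightarrow> complex) nspace"
  assumes X: "ncarrier X0 = l2" "ncarrier X1 = l2"
    "\<And>x. x \<in> l2 \<Longrightarrow> nnorm X0 x = l2norm x" "\<And>x. x \<in> l2 \<Longrightarrow> nnorm X1 x = l2norm x"
begin

lemma sum_space_l2:
  shows "dominates_coordinates (sum_space X0 X1)" and "ncarrier (sum_space X0 X1) = l2"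
    and "x \<in> l2 \<Longrightarrow> 0 \<le> nnorm (sum_space X0 X1) x"
    and "x \<in> l2 \<Longrightarrow> nnorm (sum_space X0 X1) x \<le> l2norm x"
proof -
  show S: "dominates_coordinates (sum_space X0 X1)"
    by (rule dominates_coordinates_sum_space)
       (auto simp: dominates_coordinates_def X coordinate_le_l2norm)
  then show "ncarrier (sum_space X0 X1) = l2" by (simp add: dominates_coordinates_def)
  assume x: "x \<in> l2"
  show "0 \<le> nnorm (sum_space X0 X1) x"
    using S x norm_ge_zero order_trans unfolding dominates_coordinates_def by blast
  have "nnorm X0 x + nnorm X1 0 \<in>
      {nnorm X0 x0 + nnorm X1 x1 |x0 x1. x0 \<in> ncarrier X0 \<and> x1 \<in> ncarrier X1 \<and> x = x0 + x1}"
    using x l2_0 X by (intro CollectI exI[of _ x] exI[of _ 0]) simp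
  moreover have "bdd_below {nnorm X0 x0 + nnorm X1 x1 |x0 x1.
      x0 \<in> ncarrier X0 \<and> x1 \<in> ncarrier X1 \<and> x = x0 + x1}"
    by (rule bdd_belowI[of _ 0]) (auto simp: X l2norm_nonneg)
  ultimately have "nnorm (sum_space X0 X1) x \<le> nnorm X0 x + nnorm X1 0"
    unfolding sum_space_def nspace.simps by (rule cInf_lower)
  then show "nnorm (sum_space X0 X1) x \<le> l2norm x" using x by (simp add: X l2_0 l2norm_0)
qed

lemma tendsto_nnorm_scaleC_0:
  assumes "v \<in> l2" "(g \<longlongrightarrow> 0) F"
  shows "((\<lambda>w. nnorm (sum_space X0 X1) (g w *\<^sub>C v)) \<longlongrightarrow> 0) F"
proof (rule Lim_null_comparison)
  show "\<forall>\<^sub>F w in F. norm (nnorm (sum_space X0 X1) (g w *\<^sub>C v)) \<le> cmod (g w) * l2norm v"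
    using sum_space_l2(3,4)[OF l2_scale[OF assms(1)]] by (simp add: l2norm_scale assms)
  show "((\<lambda>w. cmod (g w) * l2norm v) \<longlongrightarrow> 0) F"
    by (intro tendsto_mult_left_zero tendsto_norm_zero assms)
qed

lemma has_nderiv_exp_function:
  assumes "v \<in> l2"
  shows "has_nderiv (sum_space X0 X1) (exp_function \<mu> v)
    ((complex_of_real \<mu> * exp (complex_of_real \<mu> * (z - 1/2))) *\<^sub>C v) z"
proof -
  let ?e = "\<lambda>z. exp (complex_of_real \<mu> * (z - 1/2))"
  have "(?e has_field_derivative of_real \<mu> * ?e z) (at z)"
    by (auto intro!: derivative_eq_intros)
  then have "((\<lambda>w. (?e w - ?e z) / (w - z) - of_real \<mu> * ?e z) \<longlongrightarrow> 0) (at z)"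
    unfolding has_field_derivative_iff by (rule LIM_zero)
  from tendsto_nnorm_scaleC_0[OF assms this] show ?thesis
    unfolding has_nderiv_def sum_space_l2(2) exp_function_def
    by (simp add: l2_scale assms scaleC_scaleC flip: scaleC_diff_left)
qed

lemma exp_function_calF:
  assumes "v \<in> l2"
  shows "exp_function \<mu> v \<in> calF X0 X1"
    and "(exp_function \<mu> v (1/2), nderiv (sum_space X0 X1) (exp_function \<mu> v) (1/2)) = (v, complex_of_real \<mu> *\<^sub>C v)"
proof -
  let ?e = "\<lambda>z. exp (complex_of_real \<mu> * (z - 1/2))"
  have mem: "exp_function \<mu> v z \<in> l2" for z
    unfolding exp_function_def by (rule l2_scale[OF assms])
  have norm: "l2norm (exp_function \<mu> v z) = exp (\<mu> * (Re z - 1/2)) * l2norm v" for z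
    unfolding exp_function_def by (simp add: l2norm_scale assms)
  have "nnorm (sum_space X0 X1) (exp_function \<mu> v z) \<le> exp \<bar>\<mu>\<bar> * l2norm v" if "z \<in> strip" for z
  proof -
    have "\<mu> * (Re z - 1/2) \<le> \<bar>\<mu>\<bar> * \<bar>Re z - 1/2\<bar>" by (metis abs_ge_self abs_mult)
    also have "\<dots> \<le> \<bar>\<mu>\<bar> * 1" using that by (intro mult_left_mono) (auto simp: strip_def)
    finally have "exp (\<mu> * (Re z - 1/2)) * l2norm v \<le> exp \<bar>\<mu>\<bar> * l2norm v"
      by (intro mult_right_mono) (auto simp: l2norm_nonneg assms)
    then show ?thesis using sum_space_l2(4)[OF mem, of z] norm[of z] by linarith
  qed
  moreover have "((\<lambda>w. nnorm (sum_space X0 X1) (exp_function \<mu> v w - exp_function \<mu> v z)) \<longlongrightarrow> 0)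
      (at z within strip)" for z
  proof -
    have "(?e \<longlongrightarrow> ?e z) (at z within strip)" by (intro tendsto_intros)
    from tendsto_nnorm_scaleC_0[OF assms LIM_zero[OF this]] show ?thesis
      by (simp add: exp_function_def scaleC_diff_left)
  qed
  moreover have "\<exists>d. has_nderiv (sum_space X0 X1) (exp_function \<mu> v) d z" for z
    using has_nderiv_exp_function[OF assms] by blast
  ultimately show "exp_function \<mu> v \<in> calF X0 X1"
    unfolding calF_def sum_space_l2(2)
    using mem
    by (auto simp: X norm l2norm_nonneg assms)
  show "(exp_function \<mu> v (1/2), nderiv (sum_space X0 X1) (exp_function \<mu> v) (1/2)) = (v, complex_of_real \<mu> *\<^sub>C v)"
    using nderiv_eqI[OF sum_space_l2(1) mem half_interior_strip has_nderiv_exp_function[OF assms, of \<mu> "1/2"]]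
    by (simp add: exp_function_half)
qed

end

section \<open>Rows and columns over the couple of row and column spaces\<close>

text \<open>The matrix with the \<open>n\<close> given entries in its first column or in its first row. Treating both
  positions at once makes visible which of the later bounds depend on the position.\<close>

definition place :: "bool \<Rightarrow> nat \<Rightarrow> (nat \<Rightarrow> 'a) \<Rightarrow> nat \<Rightarrow> nat \<Rightarrow> 'a::zero" where
  "place col n y = (\<lambda>i j. if col then (if j = 0 \<and> i < n then y i else 0)
                               else (if i = 0 \<and> j < n then y j else 0))"

text \<open>For the column \<open>\<Sum>\<^sub>k x\<^sub>k x\<^sub>k\<^sup>*\<close> is \<open>|s|\<^sup>2\<close> times the identity matrix, for the row it is \<open>n |s|\<^sup>2\<close> at the
  entry \<open>(0, 0)\<close>.\<close>

lemma row_norm_place: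
  assumes "n > 0"
  shows "mnorm row_os n (\<lambda>i j. s *\<^sub>C place col n unit_vec i j)
    \<le> (if col then 1 else sqrt (real n)) * cmod s"
proof -
  define v where "v = place col n unit_vec"
  define A where "A = (\<lambda>i j. \<Sum>k. \<Sum>l<n. (s *\<^sub>C v i l) k * cnj ((s *\<^sub>C v j l) k))"
  define B where "B = (if col then 1 else real n) * (cmod s)\<^sup>2"
  have ss: "s * cnj s = complex_of_real ((cmod s)\<^sup>2)" by (rule complex_norm_square[symmetric])
  have "opnorm {..<n} {..<n} A \<le> B"
  proof (rule opnorm_diagonal_le)
    fix i j assume ij: "i \<in> {..<n}" "j \<in> {..<n}" "i \<noteq> j"
    then have "(s *\<^sub>C v i l) k * cnj ((s *\<^sub>C v j l) k) = 0" for l k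
      by (auto simp: v_def place_def scaleC_fun_def scaleC_complex_def unit_vec_def)
    then have "(\<Sum>l<n. (s *\<^sub>C v i l) k * cnj ((s *\<^sub>C v j l) k)) = 0" for k
      by (intro sum.neutral) blast
    then show "A i j = 0" by (simp only: A_def suminf_zero)
  next
    fix i assume i: "i \<in> {..<n}"
    show "cmod (A i i) \<le> B"
    proof (cases col)
      case True
      have "(\<Sum>l<n. (s *\<^sub>C v i l) k * cnj ((s *\<^sub>C v i l) k)) =
          (\<Sum>l<n. if l = 0 then (if k = i then s * cnj s else 0) else 0)" for k
        by (rule sum.cong) (use i True in \<open>auto simp: v_def place_def scaleC_fun_def scaleC_complex_def unit_vec_def\<close>)
      then have "A i i = (\<Sum>k. if k = i then s * cnj s else 0)"
        using assms by (simp add: A_def)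
      also have "\<dots> = (\<Sum>k\<in>{i}. if k = i then s * cnj s else 0)"
        by (rule suminf_finite) auto
      finally show ?thesis using True unfolding ss by (simp add: B_def norm_power)
    next
      case False
      have "(\<Sum>l<n. (s *\<^sub>C v i l) k * cnj ((s *\<^sub>C v i l) k)) =
          (\<Sum>l<n. if l = k then (if i = 0 then s * cnj s else 0) else 0)" for k
        by (rule sum.cong) (use False in \<open>auto simp: v_def place_def scaleC_fun_def scaleC_complex_def unit_vec_def\<close>)
      then have "A i i = (\<Sum>k. if k < n then (if i = 0 then s * cnj s else 0) else 0)"
        by (simp add: A_def)
      also have "\<dots> = (\<Sum>k<n. if k < n then (if i = 0 then s * cnj s else 0) else 0)"
        by (rule suminf_finite) auto
      finally have "A i i = of_nat n * (if i = 0 then s * cnj s else 0)" by simp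
      then show ?thesis using False unfolding ss by (simp add: B_def norm_mult norm_power)
    qed
  qed (auto simp: B_def)
  then have "sqrt (opnorm {..<n} {..<n} A) \<le> sqrt B" by simp
  also have "sqrt B = (if col then 1 else sqrt (real n)) * cmod s"
    by (simp add: B_def real_sqrt_mult)
  finally show ?thesis by (simp add: row_os_def A_def v_def)
qed

lemma col_norm_eq_row_norm:
  "mnorm col_os n x = mnorm row_os n (\<lambda>i j k. cnj (x j i k))"
  by (simp add: col_os_def row_os_def)

lemma col_norm_place:
  assumes "n > 0"
  shows "mnorm col_os n (\<lambda>i j. s *\<^sub>C place col n unit_vec i j)
    \<le> (if col then sqrt (real n) else 1) * cmod s"
proof -
  have "(\<lambda>i j k. cnj ((s *\<^sub>C place col n unit_vec j i) k))
      = (\<lambda>i j. cnj s *\<^sub>C place (\<not> col) n unit_vec i j)"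
    by (auto simp: fun_eq_iff place_def scaleC_fun_def scaleC_complex_def unit_vec_def)
  then show ?thesis
    using row_norm_place[OF assms, of "cnj s" "\<not> col"]
    by (cases col) (simp_all add: col_norm_eq_row_norm)
qed

text \<open>A crude bound; it ensures that the suprema over boundary lines are suprema of bounded sets.\<close>

lemma row_norm_bound:
  assumes "\<And>i j. i < n \<Longrightarrow> j < n \<Longrightarrow> x i j \<in> l2 \<and> l2norm (x i j) \<le> B"
  shows "mnorm row_os n x \<le> sqrt (real n ^ 3 * B\<^sup>2)"
proof -
  let ?A = "\<lambda>i j. \<Sum>k. \<Sum>l<n. x i l k * cnj (x j l k)"
  have "cmod (?A i j) \<le> real n * B\<^sup>2" if ij: "i < n" "j < n" for i j
  proof -
    have sq: "summable (\<lambda>k. (cmod (x i l k))\<^sup>2)" "(\<Sum>k. (cmod (x i l k))\<^sup>2) \<le> B\<^sup>2" if "i < n" "l < n" for i l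
      using assms[OF that] l2norm_nonneg[of "x i l"] power_mono[of "l2norm (x i l)" B 2]
      by (auto simp: l2_iff simp flip: l2norm_power2)
    have "cmod (?A i j) \<le> (\<Sum>l<n. ((\<Sum>k. (cmod (x i l k))\<^sup>2) + (\<Sum>k. (cmod (x j l k))\<^sup>2)) / 2)"
      by (rule norm_suminf_le_half_squares) (use sq ij in auto)
    also have "\<dots> \<le> (\<Sum>l<n. B\<^sup>2)"
    proof (rule sum_mono)
      fix l assume "l \<in> {..<n}"
      then show "((\<Sum>k. (cmod (x i l k))\<^sup>2) + (\<Sum>k. (cmod (x j l k))\<^sup>2)) / 2 \<le> B\<^sup>2"
        using sq(2)[OF ij(1), of l] sq(2)[OF ij(2), of l] by simp
    qed
    finally show ?thesis by simp
  qed
  then have "(\<Sum>i<n. \<Sum>j<n. cmod (?A i j)) \<le> (\<Sum>i<n. \<Sum>j<n. real n * B\<^sup>2)"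
    by (intro sum_mono) auto
  then have "opnorm {..<n} {..<n} ?A \<le> real n ^ 3 * B\<^sup>2"
    using opnorm_le_sum[of "{..<n}" "{..<n}" ?A] by (simp add: power3_eq_cube algebra_simps)
  then show ?thesis by (simp add: row_os_def)
qed

lemma row_norm_nonneg: "0 \<le> mnorm row_os n x"
  by (simp add: row_os_def opnorm_nonneg)

lemma uniform_bound:
  assumes "\<And>i j. i < n \<Longrightarrow> j < (n::nat) \<Longrightarrow> \<exists>B. \<forall>t. g i j t \<le> (B::real)"
  shows "\<exists>B. \<forall>i<n. \<forall>j<n. \<forall>t. g i j t \<le> B"
proof -
  obtain b where b: "\<And>i j t. i < n \<Longrightarrow> j < n \<Longrightarrow> g i j t \<le> b i j"
    using assms by metis
  define B where "B = (\<Sum>(i, j)\<in>{..<n} \<times> {..<n}. \<bar>b i j\<bar>)"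
  have "g i j t \<le> B" if "i < n" "j < n" for i j t
  proof -
    have "\<bar>b i j\<bar> \<le> B" unfolding B_def
      using member_le_sum[of "(i, j)" "{..<n} \<times> {..<n}" "\<lambda>(i, j). \<bar>b i j\<bar>"] that by auto
    then show ?thesis using b[OF that, of t] by linarith
  qed
  then show ?thesis by blast
qed

lemma range_bounded_above: "bounded (range g) \<Longrightarrow> \<exists>B. \<forall>t. g t \<le> (B::real)"
  unfolding bounded_iff by (auto intro: abs_le_D1)

text \<open>Nonnegativity makes the quotient norm of \<^const>\<open>dOH\<close> the infimum of a set that is bounded below.
  It depends on the boundedness of the matrix norms on the boundary: the supremum of an unbounded
  set of reals could be negative.\<close>

lemma mnorm_F_row_col_nonneg:
  assumes f: "f \<in> mats n (calF (underlying row_os) (underlying col_os))"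
  shows "0 \<le> mnorm (F_os row_os col_os) n f"
proof -
  let ?N = "\<lambda>t::real. mnorm row_os n (\<lambda>i j. f i j (\<i> * of_real t))"
  have fij: "f i j \<in> calF (underlying row_os) (underlying col_os)" if "i < n" "j < n" for i j
    using f that by (auto simp: mats_def)
  have mem: "f i j (\<i> * of_real t) \<in> l2" if "i < n" "j < n" for i j t
    using fij[OF that] by (simp add: calF_def underlying_row_os)
  have "\<exists>B. \<forall>i<n. \<forall>j<n. \<forall>t. nnorm (underlying row_os) (f i j (\<i> * of_real t)) \<le> B"
    by (rule uniform_bound, rule range_bounded_above) (use fij in \<open>simp add: calF_def\<close>)
  then obtain B where bound: "\<And>i j t. i < n \<Longrightarrow> j < n \<Longrightarrow>
      nnorm (underlying row_os) (f i j (\<i> * of_real t)) \<le> B" by blast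
  have B: "l2norm (f i j (\<i> * of_real t)) \<le> B" if "i < n" "j < n" for i j t
    using bound[OF that, of t] unfolding underlying_row_os(2)[OF mem[OF that]] .
  have "?N t \<le> sqrt (real n ^ 3 * B\<^sup>2)" for t
    by (intro row_norm_bound conjI mem B)
  then have "bdd_above (range ?N)" by (intro bdd_aboveI2)
  then have "?N 0 \<le> (SUP t. ?N t)" by (intro cSUP_upper) auto
  then have "0 \<le> (SUP t. ?N t)" using row_norm_nonneg order_trans by blast
  then show ?thesis by (simp add: F_os_def calF_norm_def matspace_def le_max_iff_disj)
qed

text \<open>The exponent for which the two boundary norms of the column, respectively of the row, agree. Its
  sign is the only trace that the position leaves in \<^const>\<open>dOH\<close>.\<close>

abbreviation half_log :: "bool \<Rightarrow> nat \<Rightarrow> real" where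
  "half_log col n \<equiv> (if col then - ln (real n) / 2 else ln (real n) / 2)"

abbreviation test_matrix :: "bool \<Rightarrow> nat \<Rightarrow> nat \<Rightarrow> nat \<Rightarrow> (nat \<Rightarrow> complex) \<times> (nat \<Rightarrow> complex)" where
  "test_matrix col n \<equiv> (\<lambda>i j. (place col n unit_vec i j,
     complex_of_real (half_log col n) *\<^sub>C place col n unit_vec i j))"

lemma dOH_graph_mem:
  assumes "v \<in> l2"
  shows "(v, complex_of_real \<mu> *\<^sub>C v) \<in> carrier dOH"
  using exp_function_calF[OF underlying_row_os(1) underlying_col_os(1) underlying_row_os(2) underlying_col_os(2) assms, of \<mu>]
  unfolding dOH_def d_interp_def quotient_os_def F_os_def
  by (simp del: prod.inject) (metis (no_types, lifting) image_eqI)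

lemma place_l2: "(\<And>k. k < n \<Longrightarrow> y k \<in> l2) \<Longrightarrow> place col n y i j \<in> l2"
  using l2_0 by (simp add: place_def)

lemma test_matrix_mats:
  assumes "n > 0"
  shows "test_matrix col n \<in> mats n (carrier dOH)"
  unfolding mats_def
proof (rule CollectI, intro allI, split if_split, intro conjI impI)
  fix i j assume "i < n \<and> j < n"
  show "test_matrix col n i j \<in> carrier dOH"
    by (rule dOH_graph_mem, rule place_l2, rule unit_vec_l2)
next
  fix i j assume "\<not> (i < n \<and> j < n)"
  then have "place col n unit_vec i j = 0" using assms by (auto simp: place_def)
  then show "test_matrix col n i j = 0"
    by (simp add: zero_prod_def fun_eq_iff scaleC_fun_def scaleC_complex_def)
qed

text \<open>The function \<open>z \<mapsto> exp (\<mu> (z - 1/2)) x\<close> lifts the test matrix. One of the boundary norms of \<open>x\<close> is \<open>1\<close>, the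
  other one \<open>\<surd>n\<close>, and the scalar factors turn both into \<open>exp (ln n / 4)\<close>.\<close>

lemma test_matrix_norm:
  assumes n: "n > 0"
  shows "mnorm dOH n (test_matrix col n) \<le> exp (ln (real n) / 4)"
    and "0 \<le> mnorm dOH n (test_matrix col n)"
proof -
  define \<mu> where "\<mu> = half_log col n"
  define v where "v = place col n unit_vec"
  define f where "f = (\<lambda>i j. exp_function \<mu> (v i j))"
  have v: "v i j \<in> l2" for i j unfolding v_def by (rule place_l2, rule unit_vec_l2)
  have v0: "v i j = 0" if "\<not> (i < n \<and> j < n)" for i j
    using that n by (auto simp: v_def place_def)
  note F = exp_function_calF[OF underlying_row_os(1) underlying_col_os(1) underlying_row_os(2) underlying_col_os(2) v]
  have f: "f \<in> mats n (calF (underlying row_os) (underlying col_os))"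
    unfolding mats_def f_def using F(1) v0 exp_function_0 by auto
  have sqrt_n: "sqrt (real n) = exp (ln (real n) / 2)"
    using n by (simp flip: ln_sqrt)
  have norm: "mnorm (F_os row_os col_os) n f \<le> exp (ln (real n) / 4)"
    unfolding F_os_def opspace.simps calF_norm_def matspace_def nspace.simps
  proof (rule max.boundedI; rule cSUP_least)
    fix t :: real
    let ?s = "\<lambda>z. exp (complex_of_real \<mu> * (z - 1/2))"
    show "mnorm row_os n (\<lambda>i j. f i j (\<i> * of_real t)) \<le> exp (ln (real n) / 4)"
      using row_norm_place[OF n, of "?s (\<i> * of_real t)" col]
      by (auto simp: f_def exp_function_def v_def \<mu>_def sqrt_n simp flip: exp_add)
    show "mnorm col_os n (\<lambda>i j. f i j (1 + \<i> * of_real t)) \<le> exp (ln (real n) / 4)"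
      using col_norm_place[OF n, of "?s (1 + \<i> * of_real t)" col]
      by (auto simp: f_def exp_function_def v_def \<mu>_def sqrt_n simp flip: exp_add)
  qed auto
  let ?S = "{mnorm (F_os row_os col_os) n x |x. x \<in> mats n (calF (underlying row_os) (underlying col_os)) \<and>
    (\<forall>i<n. \<forall>j<n. (x i j (1/2), nderiv (sum_space (underlying row_os) (underlying col_os)) (x i j) (1/2))
       = test_matrix col n i j)}"
  have eq: "mnorm dOH n (test_matrix col n) = Inf ?S"
    by (simp only: dOH_def d_interp_def quotient_os_def opspace.simps F_os_def)
  have "(f i j (1/2), nderiv (sum_space (underlying row_os) (underlying col_os)) (f i j) (1/2))
      = test_matrix col n i j" for i j
    using F(2)[of \<mu> i j] by (simp only: f_def v_def \<mu>_def)
  with f have mem: "mnorm (F_os row_os col_os) n f \<in> ?S" by blast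
  have nonneg: "0 \<le> r" if "r \<in> ?S" for r
    using that mnorm_F_row_col_nonneg by blast
  have "Inf ?S \<le> mnorm (F_os row_os col_os) n f"
    by (rule cInf_lower[OF mem bdd_belowI]) (rule nonneg)
  then show "mnorm dOH n (test_matrix col n) \<le> exp (ln (real n) / 4)"
    unfolding eq using norm by (rule order.trans)
  show "0 \<le> mnorm dOH n (test_matrix col n)"
    unfolding eq by (rule cInf_greatest[OF nonempty_of_member[OF mem]]) (rule nonneg)
qed

section \<open>Minimal and maximal matrix norms\<close>

lemma sum_fun_apply: "(\<Sum>k\<in>S. f k) m = (\<Sum>k\<in>S. f k m)"
  by (induction S rule: infinite_finite_induct) auto

lemma zero_dual_ball: "(\<lambda>_. 0) \<in> dual_ball ell2"
  by (auto simp: dual_ball_def clinear_on_def scaleC_complex_def l2norm_nonneg)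

lemma coordinate_dual_ball: "(\<lambda>x. x m) \<in> dual_ball ell2"
  by (auto simp: dual_ball_def clinear_on_def scaleC_complex_def scaleC_fun_def coordinate_le_l2norm)

lemma min_norm_leI:
  assumes "\<And>f i j. f \<in> dual_ball ell2 \<Longrightarrow> i < n \<Longrightarrow> j < n \<Longrightarrow> cmod (f (x i j)) \<le> B"
  shows "mnorm (min_os ell2) n x \<le> real n * (real n * B)"
  unfolding min_os_def opspace.simps
proof (rule cSUP_least)
  fix f assume f: "f \<in> dual_ball ell2"
  have "opnorm {..<n} {..<n} (\<lambda>i j. f (x i j)) \<le> (\<Sum>i<n. \<Sum>j<n. cmod (f (x i j)))"
    by (rule opnorm_le_sum) simp
  also have "\<dots> \<le> (\<Sum>i<n. \<Sum>j<n. B)" by (intro sum_mono assms f) auto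
  finally show "opnorm {..<n} {..<n} (\<lambda>i j. f (x i j)) \<le> real n * (real n * B)" by simp
qed (use zero_dual_ball in blast)

lemma dual_le_min_norm:
  assumes "\<And>i j. i < n \<Longrightarrow> j < n \<Longrightarrow> x i j \<in> l2" "f \<in> dual_ball ell2" "i < n" "j < n"
  shows "cmod (f (x i j)) \<le> mnorm (min_os ell2) n x"
proof -
  have "cmod (f (x i j)) \<le> opnorm {..<n} {..<n} (\<lambda>i j. f (x i j))"
    by (rule entry_le_opnorm) (use assms in auto)
  also have "\<dots> \<le> (SUP f\<in>dual_ball ell2. opnorm {..<n} {..<n} (\<lambda>i j. f (x i j)))"
  proof (rule cSUP_upper[OF assms(2)], rule bdd_aboveI2)
    fix f assume f: "f \<in> dual_ball ell2"
    have "opnorm {..<n} {..<n} (\<lambda>i j. f (x i j)) \<le> (\<Sum>i<n. \<Sum>j<n. cmod (f (x i j)))"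
      by (rule opnorm_le_sum) simp
    also have "\<dots> \<le> (\<Sum>i<n. \<Sum>j<n. l2norm (x i j))"
      using f assms(1) by (intro sum_mono) (auto simp: dual_ball_def)
    finally show "opnorm {..<n} {..<n} (\<lambda>i j. f (x i j)) \<le> (\<Sum>i<n. \<Sum>j<n. l2norm (x i j))" .
  qed
  finally show ?thesis by (simp add: min_os_def)
qed

lemma underlying_min:
  shows "ncarrier (underlying (min_os ell2)) = l2"
    and "x \<in> l2 \<Longrightarrow> f \<in> dual_ball ell2 \<Longrightarrow> cmod (f x) \<le> nnorm (underlying (min_os ell2)) x"
    and "dominates_coordinates (underlying (min_os ell2))"
proof -
  show c: "ncarrier (underlying (min_os ell2)) = l2" by (simp add: underlying_def min_os_def)
  show "x \<in> l2 \<Longrightarrow> f \<in> dual_ball ell2 \<Longrightarrow> cmod (f x) \<le> nnorm (underlying (min_os ell2)) x" for x f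
    using dual_le_min_norm[of 1 "\<lambda>i j. if i = 0 \<and> j = 0 then x else 0" f 0 0]
    by (simp add: underlying_def)
  then show "dominates_coordinates (underlying (min_os ell2))"
    using c coordinate_dual_ball by (auto simp: dominates_coordinates_def)
qed

text \<open>Names for the admissible factorizations \<open>x = A D B\<close> and for \<open>\<parallel>A\<parallel> \<parallel>D\<parallel> \<parallel>B\<parallel>\<close> let the estimates be made
  for one factorization at a time.\<close>

definition factorization ::
  "nat \<Rightarrow> (nat \<Rightarrow> nat \<Rightarrow> nat \<Rightarrow> complex) \<Rightarrow> nat \<Rightarrow> (nat \<Rightarrow> nat \<Rightarrow> complex) \<Rightarrow>
   (nat \<Rightarrow> nat \<Rightarrow> complex) \<Rightarrow> (nat \<Rightarrow> nat \<Rightarrow> complex) \<Rightarrow> bool" where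
  "factorization n x m A d B \<longleftrightarrow> m > 0 \<and> (\<forall>k<m. d k \<in> l2) \<and>
     (\<forall>i<n. \<forall>j<n. x i j = (\<Sum>k<m. (A i k * B k j) *\<^sub>C d k))"

definition factor_cost ::
  "nat \<Rightarrow> nat \<Rightarrow> (nat \<Rightarrow> nat \<Rightarrow> complex) \<Rightarrow> (nat \<Rightarrow> nat \<Rightarrow> complex) \<Rightarrow> (nat \<Rightarrow> nat \<Rightarrow> complex) \<Rightarrow> real" where
  "factor_cost n m A d B = opnorm {..<n} {..<m} A * Max ((\<lambda>k. l2norm (d k)) ` {..<m})
     * opnorm {..<m} {..<n} B"

lemma max_norm_eq:
  "mnorm (max_os ell2) n x = Inf {factor_cost n m A d B | m A d B. factorization n x m A d B}"
  by (simp add: max_os_def factor_cost_def factorization_def)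

lemma norm_le_Max:
  "k < (m::nat) \<Longrightarrow> l2norm (d k) \<le> Max ((\<lambda>k. l2norm (d k)) ` {..<m})"
  by (intro Max_ge) auto

lemma Max_l2norm_factorization_nonneg:
  "factorization n x m A d B \<Longrightarrow> 0 \<le> Max ((\<lambda>k. l2norm (d k)) ` {..<m})"
  unfolding factorization_def
  by (rule order.trans[OF l2norm_nonneg[of "d 0"] norm_le_Max[of 0 m d]]) auto

lemma factor_cost_nonneg: "factorization n x m A d B \<Longrightarrow> 0 \<le> factor_cost n m A d B"
  unfolding factor_cost_def by (intro mult_nonneg_nonneg opnorm_nonneg Max_l2norm_factorization_nonneg) auto

text \<open>\<open>x\<close> is the sum of its entries times matrix units; the pair of indices of an entry is encoded by
  \<open>k = i n + j\<close>.\<close>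

lemma entry_factorization:
  fixes n :: nat
  assumes n: "n > 0"
  defines "A \<equiv> \<lambda>i k. if k div n = i then 1 else 0 :: complex"
    and "B \<equiv> \<lambda>k j. if k mod n = j then 1 else 0 :: complex"
  assumes x: "\<And>i j. i < n \<Longrightarrow> j < n \<Longrightarrow> x i j \<in> l2"
  shows "factorization n x (n * n) A (\<lambda>k. x (k div n) (k mod n)) B"
  unfolding factorization_def
proof (intro conjI allI impI)
  show "0 < n * n" using n by simp
  show "x (k div n) (k mod n) \<in> l2" if "k < n * n" for k
    using that n by (intro x) (auto simp: less_mult_imp_div_less)
  fix i j assume ij: "i < n" "j < n"
  have k0: "i * n + j < n * n"
  proof -
    have "i * n + j < (i + 1) * n" using ij by simp
    also have "\<dots> \<le> n * n" using ij by (intro mult_le_mono1) simp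
    finally show ?thesis .
  qed
  have "(\<Sum>k<n * n. (A i k * B k j) *\<^sub>C x (k div n) (k mod n))
      = (\<Sum>k<n * n. if k = i * n + j then x i j else 0)"
  proof (rule sum.cong)
    fix k assume "k \<in> {..<n * n}"
    show "(A i k * B k j) *\<^sub>C x (k div n) (k mod n) = (if k = i * n + j then x i j else 0)"
    proof (cases "k = i * n + j")
      case True
      then have "k div n = i" "k mod n = j" using ij by auto
      then show ?thesis using True by (simp add: A_def B_def scaleC_one)
    next
      case False
      then have "k div n \<noteq> i \<or> k mod n \<noteq> j" by (metis div_mult_mod_eq)
      then have "A i k * B k j = 0" by (auto simp: A_def B_def)
      then have "(A i k * B k j) *\<^sub>C x (k div n) (k mod n) = 0" by (simp only: scaleC_0)
      then show ?thesis using False by (simp only: if_False)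
    qed
  qed simp
  also have "\<dots> = x i j" by (subst sum.delta) (use k0 in auto)
  finally show "x i j = (\<Sum>k<n * n. (A i k * B k j) *\<^sub>C x (k div n) (k mod n))" ..
qed

text \<open>The constant depends on \<open>n\<close> only, so entrywise boundedness of a matrix of functions gives boundedness in
  \<open>M\<^sub>n(max(\<ell>\<^sub>2))\<close>.\<close>

lemma max_norm_bounded_by_entries:
  fixes n :: nat
  assumes n: "n > 0"
  shows "\<exists>C. \<forall>x b. (\<forall>i<n. \<forall>j<n. x i j \<in> l2 \<and> l2norm (x i j) \<le> b) \<longrightarrow> mnorm (max_os ell2) n x \<le> C * b"
proof (intro exI allI impI)
  fix x :: "nat \<Rightarrow> nat \<Rightarrow> nat \<Rightarrow> complex" and b
  assume x: "\<forall>i<n. \<forall>j<n. x i j \<in> l2 \<and> l2norm (x i j) \<le> b"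
  let ?A = "\<lambda>i k. if k div n = i then 1 else 0 :: complex"
  let ?B = "\<lambda>k j. if k mod n = j then 1 else 0 :: complex"
  let ?d = "\<lambda>k. x (k div n) (k mod n)"
  have fac: "factorization n x (n * n) ?A ?d ?B" using entry_factorization[OF n] x by blast
  have "mnorm (max_os ell2) n x \<le> factor_cost n (n * n) ?A ?d ?B"
    unfolding max_norm_eq
    by (rule cInf_lower) (use fac in \<open>auto intro!: bdd_belowI[of _ 0] factor_cost_nonneg\<close>)
  also have "\<dots> \<le> opnorm {..<n} {..<n * n} ?A * b * opnorm {..<n * n} {..<n} ?B"
    unfolding factor_cost_def
  proof (intro mult_right_mono mult_left_mono opnorm_nonneg)
    show "Max ((\<lambda>k. l2norm (?d k)) ` {..<n * n}) \<le> b"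
      using n x by (subst Max_le_iff) (auto simp: less_mult_imp_div_less lessThan_empty_iff)
  qed auto
  finally show "mnorm (max_os ell2) n x \<le> (opnorm {..<n} {..<n * n} ?A * opnorm {..<n * n} {..<n} ?B) * b"
    by (simp add: mult_ac)
qed

lemma max_norm_lessD:
  assumes "n > 0" "\<And>i j. i < n \<Longrightarrow> j < n \<Longrightarrow> x i j \<in> l2" "mnorm (max_os ell2) n x < M"
  obtains m A d B where "factorization n x m A d B" "factor_cost n m A d B < M"
proof -
  let ?S = "{factor_cost n m A d B | m A d B. factorization n x m A d B}"
  have "\<exists>m A d B. factorization n x m A d B"
    by (intro exI) (rule entry_factorization[OF assms(1,2)])
  then obtain m A d B where "factorization n x m A d B" by (elim exE)
  then have "factor_cost n m A d B \<in> ?S" by blast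
  then have "?S \<noteq> {}" by (rule nonempty_of_member)
  moreover have "Inf ?S < M" using assms(3) by (simp only: max_norm_eq)
  ultimately obtain c where "c \<in> ?S" "c < M" using cInf_lessD by meson
  then show thesis using that by auto
qed

lemma l2norm_entry_le_max_norm:
  assumes "n > 0" "\<And>i j. i < n \<Longrightarrow> j < n \<Longrightarrow> x i j \<in> l2" "i < n" "j < n"
  shows "l2norm (x i j) \<le> mnorm (max_os ell2) n x"
proof (rule dense_ge)
  fix M assume "mnorm (max_os ell2) n x < M"
  from max_norm_lessD[OF assms(1,2) this]
  obtain m A d B where fac: "factorization n x m A d B" and M: "factor_cost n m A d B < M" by blast
  define D where "D = Max ((\<lambda>k. l2norm (d k)) ` {..<m})"
  have D: "0 \<le> D" "\<And>k. k < m \<Longrightarrow> l2norm (d k) \<le> D"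
    unfolding D_def using Max_l2norm_factorization_nonneg[OF fac] norm_le_Max by auto
  have "l2norm (x i j) \<le> (\<Sum>k<m. cmod (A i k * B k j) * l2norm (d k))"
    using fac l2_sum[of "{..<m}" d "\<lambda>k. A i k * B k j"] assms(3,4) unfolding factorization_def by auto
  also have "\<dots> \<le> (\<Sum>k<m. cmod (A i k * B k j) * D)"
    by (intro sum_mono mult_left_mono D) auto
  also have "\<dots> = (\<Sum>k<m. \<bar>cmod (A i k)\<bar> * \<bar>cmod (B k j)\<bar>) * D"
    by (simp add: norm_mult sum_distrib_right)
  also have "\<dots> \<le> (L2_set (\<lambda>k. cmod (A i k)) {..<m} * L2_set (\<lambda>k. cmod (B k j)) {..<m}) * D"
    by (intro mult_right_mono L2_set_mult_ineq D)
  also have "\<dots> \<le> (opnorm {..<n} {..<m} A * opnorm {..<m} {..<n} B) * D"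
    by (intro mult_right_mono mult_mono row_le_opnorm column_le_opnorm opnorm_nonneg D) (use assms in auto)
  also have "\<dots> = factor_cost n m A d B" by (simp add: factor_cost_def D_def)
  finally show "l2norm (x i j) \<le> M" using M by simp
qed

lemma underlying_max:
  shows "ncarrier (underlying (max_os ell2)) = l2"
    and "x \<in> l2 \<Longrightarrow> l2norm x \<le> nnorm (underlying (max_os ell2)) x"
    and "dominates_coordinates (underlying (max_os ell2))"
proof -
  show c: "ncarrier (underlying (max_os ell2)) = l2" by (simp add: underlying_def max_os_def)
  show le: "x \<in> l2 \<Longrightarrow> l2norm x \<le> nnorm (underlying (max_os ell2)) x" for x
    using l2norm_entry_le_max_norm[of 1 "\<lambda>i j. if i = 0 \<and> j = 0 then x else 0" 0 0]
    by (simp add: underlying_def)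
  show "dominates_coordinates (underlying (max_os ell2))"
    using c order.trans[OF coordinate_le_l2norm le] by (auto simp: dominates_coordinates_def)
qed

definition line :: "bool \<Rightarrow> (nat \<Rightarrow> nat \<Rightarrow> 'a) \<Rightarrow> nat \<Rightarrow> 'a" where
  "line col x k = (if col then x k 0 else x 0 k)"

text \<open>Let \<open>x = A D B\<close>. In the chosen row or column \<open>x\<^sub>k = \<Sum>\<^sub>j u\<^sub>k\<^sub>j w\<^sub>j d\<^sub>j\<close>, where \<open>w\<close> is a row or column of one of the
  scalar factors and \<open>u\<close> is, up to transposition, the other factor. By the Cauchy--Schwarz inequality over all pairs \<open>(k, j)\<close> the pairing
  is at most the Hilbert--Schmidt norm of \<open>u\<close>, which is at most \<open>\<surd>n\<close> times its operator norm,
  times the norm of the family \<open>w\<^sub>j \<phi>\<^sub>k(d\<^sub>j)\<close>, in which the sum over \<open>k\<close> is controlled by the hypothesis on \<open>\<phi>\<close>.\<close>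

lemma max_norm_pairing:
  assumes n: "n > 0" and x: "\<And>i j. i < n \<Longrightarrow> j < n \<Longrightarrow> x i j \<in> l2"
    and M: "mnorm (max_os ell2) n x < M"
    and lin: "\<And>k. clinear_on l2 (\<phi> k)"
    and a: "0 \<le> a" and \<phi>: "\<And>d. d \<in> l2 \<Longrightarrow> L2_set (\<lambda>k. cmod (\<phi> k d)) {..<n} \<le> a * l2norm d"
  shows "cmod (\<Sum>k<n. \<phi> k (line col x k)) \<le> sqrt (real n) * a * M"
proof -
  obtain m A d B where fac: "factorization n x m A d B" and cost: "factor_cost n m A d B < M"
    using max_norm_lessD[OF n x M] by blast
  define D where "D = Max ((\<lambda>k. l2norm (d k)) ` {..<m})"
  have D: "0 \<le> D" "\<And>k. k < m \<Longrightarrow> l2norm (d k) \<le> D"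
    unfolding D_def using Max_l2norm_factorization_nonneg[OF fac] norm_le_Max by auto
  have d: "\<And>j. j \<in> {..<m} \<Longrightarrow> d j \<in> l2" using fac by (auto simp: factorization_def)
  define u where "u = (\<lambda>k j. if col then A k j else B j k)"
  define w where "w = (\<lambda>j. if col then B j 0 else A 0 j)"
  define s where "s = (if col then opnorm {..<n} {..<m} A else opnorm {..<m} {..<n} B)"
  define r where "r = (if col then opnorm {..<m} {..<n} B else opnorm {..<n} {..<m} A)"
  have s: "0 \<le> s" and r: "0 \<le> r" by (auto simp: s_def r_def opnorm_nonneg)
  have u: "L2_set (\<lambda>j. cmod (u k j)) {..<m} \<le> s" if "k < n" for k
    using that row_le_opnorm[of "{..<n}" "{..<m}" k A] column_le_opnorm[of "{..<n}" k B "{..<m}"]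
    by (auto simp: u_def s_def)
  have w: "L2_set (\<lambda>j. cmod (w j)) {..<m} \<le> r"
    using n row_le_opnorm[of "{..<n}" "{..<m}" 0 A] column_le_opnorm[of "{..<n}" 0 B "{..<m}"]
    by (auto simp: w_def r_def)
  have line: "line col x k = (\<Sum>j<m. (u k j * w j) *\<^sub>C d j)" if "k < n" for k
    using fac n that by (auto simp: line_def u_def w_def factorization_def mult.commute)
  let ?J = "{..<n} \<times> {..<m}"
  have "cmod (\<Sum>k<n. \<phi> k (line col x k)) = cmod (\<Sum>k<n. \<Sum>j<m. (u k j * w j) * \<phi> k (d j))"
    using line clinear_on_sum[OF lin finite_lessThan d] by (simp add: scaleC_complex_def)
  also have "\<dots> = cmod (\<Sum>(k, j)\<in>?J. (u k j * w j) * \<phi> k (d j))"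
    by (simp only: sum.cartesian_product)
  also have "\<dots> \<le> (\<Sum>(k, j)\<in>?J. \<bar>cmod (u k j)\<bar> * \<bar>cmod (w j) * cmod (\<phi> k (d j))\<bar>)"
    by (rule order.trans[OF norm_sum]) (auto intro!: sum_mono simp: norm_mult)
  also have "\<dots> \<le> L2_set (\<lambda>(k, j). cmod (u k j)) ?J * L2_set (\<lambda>(k, j). cmod (w j) * cmod (\<phi> k (d j))) ?J"
    using L2_set_mult_ineq[of "\<lambda>(k, j). cmod (u k j)" "\<lambda>(k, j). cmod (w j) * cmod (\<phi> k (d j))" ?J]
    by (simp add: case_prod_unfold)
  also have "\<dots> \<le> (sqrt (real n) * s) * (a * D * r)"
  proof (rule mult_mono)
    have "(\<Sum>k<n. \<Sum>j<m. (cmod (u k j))\<^sup>2) \<le> (\<Sum>k<n. s\<^sup>2)"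
    proof (rule sum_mono)
      fix k assume "k \<in> {..<n}"
      then show "(\<Sum>j<m. (cmod (u k j))\<^sup>2) \<le> s\<^sup>2"
        using u[of k] unfolding L2_set_def by (intro sqrt_le_D) auto
    qed
    then have "sqrt (\<Sum>k<n. \<Sum>j<m. (cmod (u k j))\<^sup>2) \<le> sqrt (real n * s\<^sup>2)" by simp
    then show "L2_set (\<lambda>(k, j). cmod (u k j)) ?J \<le> sqrt (real n) * s"
      using s by (simp add: L2_set_def sum.cartesian_product case_prod_unfold real_sqrt_mult)
    have "(\<Sum>k<n. \<Sum>j<m. (cmod (w j) * cmod (\<phi> k (d j)))\<^sup>2) = (\<Sum>j<m. (cmod (w j))\<^sup>2 * (\<Sum>k<n. (cmod (\<phi> k (d j)))\<^sup>2))"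
      by (subst sum.swap) (simp add: power_mult_distrib sum_distrib_left)
    also have "\<dots> \<le> (\<Sum>j<m. (cmod (w j))\<^sup>2 * (a * D)\<^sup>2)"
    proof (intro sum_mono mult_left_mono)
      fix j assume j: "j \<in> {..<m}"
      have "L2_set (\<lambda>k. cmod (\<phi> k (d j))) {..<n} \<le> a * D"
        using \<phi>[OF d[OF j]] mult_left_mono[OF D(2) a, of j] j by auto
      then show "(\<Sum>k<n. (cmod (\<phi> k (d j)))\<^sup>2) \<le> (a * D)\<^sup>2"
        unfolding L2_set_def by (rule sqrt_le_D)
    qed auto
    also have "\<dots> = (\<Sum>j<m. (cmod (w j))\<^sup>2) * (a * D)\<^sup>2" by (simp add: sum_distrib_right)
    also have "\<dots> \<le> r\<^sup>2 * (a * D)\<^sup>2"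
      using w unfolding L2_set_def by (intro mult_right_mono[OF sqrt_le_D zero_le_power2])
    finally have "(\<Sum>k<n. \<Sum>j<m. (cmod (w j) * cmod (\<phi> k (d j)))\<^sup>2) \<le> (a * D * r)\<^sup>2"
      by (simp add: power_mult_distrib mult_ac)
    moreover have "0 \<le> a * D * r" using a D r by simp
    ultimately have "sqrt (\<Sum>k<n. \<Sum>j<m. (cmod (w j) * cmod (\<phi> k (d j)))\<^sup>2) \<le> a * D * r"
      by (simp add: real_le_lsqrt)
    then show "L2_set (\<lambda>(k, j). cmod (w j) * cmod (\<phi> k (d j))) ?J \<le> a * D * r"
      by (simp add: L2_set_def sum.cartesian_product case_prod_unfold)
  qed (use s in auto)
  also have "\<dots> = sqrt (real n) * a * factor_cost n m A d B"
    by (simp add: factor_cost_def s_def r_def D_def)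
  also have "\<dots> \<le> sqrt (real n) * a * M" using cost a by (intro mult_left_mono) auto
  finally show ?thesis .
qed

text \<open>Each \<open>\<phi>\<^sub>k\<close> is \<open>a\<close> times a member of the dual ball, which bounds the \<open>n\<close> terms one by one. The factor
  \<open>n\<close>, compared with \<open>\<surd>n\<close> for the max norm, is the gap that produces the logarithm.\<close>

lemma min_norm_pairing:
  assumes n: "n > 0" and x: "\<And>i j. i < n \<Longrightarrow> j < n \<Longrightarrow> x i j \<in> l2"
    and M: "mnorm (min_os ell2) n x \<le> M"
    and lin: "\<And>k. clinear_on l2 (\<phi> k)"
    and a: "0 < a" and \<phi>: "\<And>d. d \<in> l2 \<Longrightarrow> L2_set (\<lambda>k. cmod (\<phi> k d)) {..<n} \<le> a * l2norm d"
  shows "cmod (\<Sum>k<n. \<phi> k (line col x k)) \<le> real n * a * M"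
proof -
  have "cmod (\<phi> k (line col x k)) \<le> a * M" if k: "k < n" for k
  proof -
    let ?f = "\<lambda>v. \<phi> k v / complex_of_real a"
    have "cmod (\<phi> k v) \<le> a * l2norm v" if "v \<in> l2" for v
      using member_le_L2_set[of "{..<n}" k "\<lambda>k. cmod (\<phi> k v)"] \<phi>[OF that] k by simp
    then have f: "?f \<in> dual_ball ell2"
      using lin[of k] a
      by (auto simp: dual_ball_def clinear_on_def scaleC_complex_def norm_divide field_simps)
    have "cmod (?f (line col x k)) \<le> mnorm (min_os ell2) n x"
      using dual_le_min_norm[of n x ?f, OF x f] n k by (simp add: line_def)
    then have "cmod (?f (line col x k)) \<le> M" using M by simp
    then show ?thesis using a by (simp add: norm_divide field_simps)
  qed
  then have "(\<Sum>k<n. cmod (\<phi> k (line col x k))) \<le> (\<Sum>k<n. a * M)" by (intro sum_mono) auto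
  then show ?thesis using norm_sum[of "\<lambda>k. \<phi> k (line col x k)" "{..<n}"] by (simp add: mult.assoc)
qed

section \<open>Rows and columns over the couple of minimal and maximal spaces\<close>

text \<open>\<^const>\<open>calF\<close> requires boundedness on the boundary for each entry only; with it the matrix norms are bounded,
  and the supremum over a boundary line dominates its values.\<close>

lemma calF_boundary_norms_bounded:
  assumes n: "n > 0"
    and f: "f \<in> mats n (calF (underlying (min_os ell2)) (underlying (max_os ell2)))"
  shows "mnorm (min_os ell2) n (\<lambda>i j. f i j (\<i> * of_real t)) \<le> mnorm (F_os (min_os ell2) (max_os ell2)) n f"
    and "mnorm (max_os ell2) n (\<lambda>i j. f i j (1 + \<i> * of_real t)) \<le> mnorm (F_os (min_os ell2) (max_os ell2)) n f"
proof -
  let ?X0 = "underlying (min_os ell2)" and ?X1 = "underlying (max_os ell2)"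
  have fij: "f i j \<in> calF ?X0 ?X1" if "i < n" "j < n" for i j
    using f that by (auto simp: mats_def)
  have mem0: "f i j (\<i> * of_real t) \<in> l2" and mem1: "f i j (1 + \<i> * of_real t) \<in> l2"
    if "i < n" "j < n" for i j t
    using fij[OF that] by (auto simp: calF_def underlying_min(1) underlying_max(1))
  have "\<exists>B. \<forall>i<n. \<forall>j<n. \<forall>t. nnorm ?X0 (f i j (\<i> * of_real t)) \<le> B"
    by (rule uniform_bound, rule range_bounded_above) (use fij in \<open>simp add: calF_def\<close>)
  then obtain B0 where B0: "\<And>i j t. i < n \<Longrightarrow> j < n \<Longrightarrow> nnorm ?X0 (f i j (\<i> * of_real t)) \<le> B0" by blast
  have "\<exists>B. \<forall>i<n. \<forall>j<n. \<forall>t. nnorm ?X1 (f i j (1 + \<i> * of_real t)) \<le> B"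
    by (rule uniform_bound, rule range_bounded_above) (use fij in \<open>simp add: calF_def\<close>)
  then obtain B1 where B1: "\<And>i j t. i < n \<Longrightarrow> j < n \<Longrightarrow> nnorm ?X1 (f i j (1 + \<i> * of_real t)) \<le> B1" by blast
  have F: "mnorm (F_os (min_os ell2) (max_os ell2)) n f =
      max (SUP t::real. mnorm (min_os ell2) n (\<lambda>i j. f i j (\<i> * of_real t)))
          (SUP t::real. mnorm (max_os ell2) n (\<lambda>i j. f i j (1 + \<i> * of_real t)))"
    by (simp add: F_os_def calF_norm_def matspace_def)
  have "mnorm (min_os ell2) n (\<lambda>i j. f i j (\<i> * of_real t)) \<le> real n * (real n * B0)" for t
  proof (rule min_norm_leI)
    fix g i j assume "g \<in> dual_ball ell2" "i < n" "j < n"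
    then show "cmod (g (f i j (\<i> * of_real t))) \<le> B0"
      by (intro order.trans[OF underlying_min(2) B0] mem0)
  qed
  then have "mnorm (min_os ell2) n (\<lambda>i j. f i j (\<i> * of_real t))
      \<le> (SUP t::real. mnorm (min_os ell2) n (\<lambda>i j. f i j (\<i> * of_real t)))"
    by (intro cSUP_upper bdd_aboveI2) auto
  then show "mnorm (min_os ell2) n (\<lambda>i j. f i j (\<i> * of_real t)) \<le> mnorm (F_os (min_os ell2) (max_os ell2)) n f"
    unfolding F by simp
  obtain C where C: "\<And>x b. (\<forall>i<n. \<forall>j<n. x i j \<in> l2 \<and> l2norm (x i j) \<le> b) \<Longrightarrow> mnorm (max_os ell2) n x \<le> C * b"
    using max_norm_bounded_by_entries[OF n] by blast
  have "mnorm (max_os ell2) n (\<lambda>i j. f i j (1 + \<i> * of_real t)) \<le> C * B1" for t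
  proof (rule C, intro allI impI conjI)
    fix i j assume "i < n" "j < n"
    then show "f i j (1 + \<i> * of_real t) \<in> l2" "l2norm (f i j (1 + \<i> * of_real t)) \<le> B1"
      by (auto intro: mem1 order.trans[OF underlying_max(2) B1])
  qed
  then have "mnorm (max_os ell2) n (\<lambda>i j. f i j (1 + \<i> * of_real t))
      \<le> (SUP t::real. mnorm (max_os ell2) n (\<lambda>i j. f i j (1 + \<i> * of_real t)))"
    by (intro cSUP_upper bdd_aboveI2) auto
  then show "mnorm (max_os ell2) n (\<lambda>i j. f i j (1 + \<i> * of_real t)) \<le> mnorm (F_os (min_os ell2) (max_os ell2)) n f"
    unfolding F by simp
qed

lemma do_ell2_lift:
  assumes X: "\<And>i j. i < n \<Longrightarrow> j < n \<Longrightarrow> X i j \<in> carrier do_ell2" and M: "mnorm do_ell2 n X < M"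
  obtains f where "f \<in> mats n (calF (underlying (min_os ell2)) (underlying (max_os ell2)))"
    and "mnorm (F_os (min_os ell2) (max_os ell2)) n f < M"
    and "\<And>i j. i < n \<Longrightarrow> j < n \<Longrightarrow> f i j (1/2) = fst (X i j)"
    and "\<And>i j. i < n \<Longrightarrow> j < n \<Longrightarrow>
      nderiv (sum_space (underlying (min_os ell2)) (underlying (max_os ell2))) (f i j) (1/2) = snd (X i j)"
proof -
  let ?F = "calF (underlying (min_os ell2)) (underlying (max_os ell2))"
  let ?q = "\<lambda>f. (f (1/2), nderiv (sum_space (underlying (min_os ell2)) (underlying (max_os ell2))) f (1/2))"
  let ?S = "{mnorm (F_os (min_os ell2) (max_os ell2)) n x | x. x \<in> mats n ?F \<and> (\<forall>i<n. \<forall>j<n. ?q (x i j) = X i j)}"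
  have car: "carrier do_ell2 = ?q ` ?F" and norm: "mnorm do_ell2 n X = Inf ?S"
    by (simp_all add: do_ell2_def d_interp_def quotient_os_def F_os_def)
  define lifts where "lifts = (\<lambda>i j h. h \<in> ?F \<and> ?q h = X i j)"
  define g where "g = (\<lambda>i j. Eps (lifts i j))"
  have g: "g i j \<in> ?F \<and> ?q (g i j) = X i j" if ij: "i < n" "j < n" for i j
  proof -
    obtain h where "X i j = ?q h" "h \<in> ?F" using X[OF ij] unfolding car by (rule imageE)
    then have "lifts i j h" by (simp add: lifts_def)
    then have "lifts i j (g i j)" unfolding g_def by (rule someI[of "lifts i j"])
    then show ?thesis by (simp only: lifts_def)
  qed
  define x where "x = (\<lambda>i j. if i < n \<and> j < n then g i j else 0)"
  have "x \<in> mats n ?F" "\<forall>i<n. \<forall>j<n. ?q (x i j) = X i j"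
    using g by (auto simp: x_def mats_def)
  then have "mnorm (F_os (min_os ell2) (max_os ell2)) n x \<in> ?S" by blast
  then have "?S \<noteq> {}" by (rule nonempty_of_member)
  moreover have "Inf ?S < M" using M norm by simp
  ultimately obtain c where "c \<in> ?S" "c < M" using cInf_lessD by meson
  then obtain f where "f \<in> mats n ?F" "mnorm (F_os (min_os ell2) (max_os ell2)) n f < M"
    and q: "\<forall>i<n. \<forall>j<n. ?q (f i j) = X i j" by blast
  moreover have "f i j (1/2) = fst (X i j)"
    "nderiv (sum_space (underlying (min_os ell2)) (underlying (max_os ell2))) (f i j) (1/2) = snd (X i j)"
    if "i < n" "j < n" for i j
    using q that by (metis fst_conv, metis snd_conv)
  ultimately show thesis using that by blast
qed

text \<open>The inner product with \<open>y\<close> is truncated, so that its composition with a member of \<^const>\<open>calF\<close> is a finite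
  sum of scalar analytic functions.\<close>

definition finite_functional :: "nat \<Rightarrow> (nat \<Rightarrow> complex) \<Rightarrow> (nat \<Rightarrow> complex) \<Rightarrow> complex" where
  "finite_functional P y v = (\<Sum>m<P. v m * cnj (y m))"

lemma clinear_finite_functional: "clinear_on V (finite_functional P y)"
  by (auto simp: clinear_on_def finite_functional_def scaleC_fun_def scaleC_complex_def
      sum.distrib sum_distrib_left algebra_simps)

text \<open>The scalar function \<open>h(z) = exp ((ln n / 2) (z - 1/2)) \<Sum>\<^sub>k \<phi>\<^sub>k(F\<^sub>k(z))\<close> is bounded by \<open>n a M\<close> on both boundary
  lines, and the left-hand side below is \<open>h'(1/2)\<close>. The sign of the logarithm does not depend on
  whether the entries are those of a row or of a column.\<close>

lemma do_ell2_line_estimate: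
  assumes n: "n > 0" and X: "\<And>i j. i < n \<Longrightarrow> j < n \<Longrightarrow> X i j \<in> carrier do_ell2"
    and M: "mnorm do_ell2 n X < exp (ln (real n) / 4) * M"
    and a: "0 < a"
    and \<phi>: "\<And>d. d \<in> l2 \<Longrightarrow> L2_set (\<lambda>k. cmod (finite_functional P (y k) d)) {..<n} \<le> a * l2norm d"
  shows "cmod ((\<Sum>k<n. finite_functional P (y k) (snd (line col X k)))
      + (ln (real n) / 2) * (\<Sum>k<n. finite_functional P (y k) (fst (line col X k)))) \<le> 2 * (real n * a * M)"
proof -
  let ?X0 = "underlying (min_os ell2)" and ?X1 = "underlying (max_os ell2)"
  let ?\<phi> = "\<lambda>k. finite_functional P (y k)"
  define Q where "Q = exp (ln (real n) / 4)"
  define l where "l = complex_of_real (ln (real n) / 2)"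
  obtain f where f: "f \<in> mats n (calF ?X0 ?X1)"
    and norm: "mnorm (F_os (min_os ell2) (max_os ell2)) n f < Q * M"
    and val: "\<And>i j. i < n \<Longrightarrow> j < n \<Longrightarrow> f i j (1/2) = fst (X i j)"
    and der: "\<And>i j. i < n \<Longrightarrow> j < n \<Longrightarrow> nderiv (sum_space ?X0 ?X1) (f i j) (1/2) = snd (X i j)"
    using do_ell2_lift[OF X M] unfolding Q_def by blast
  have fij: "f i j \<in> calF ?X0 ?X1" if "i < n" "j < n" for i j
    using f that by (auto simp: mats_def)
  note coord = calF_coordinate[OF underlying_min(3) underlying_max(3)]
  define u where "u = line col f"
  have u: "u k \<in> calF ?X0 ?X1" if "k < n" for k
    using fij n that by (simp add: u_def line_def)
  define h where "h = (\<lambda>z. exp (l * (z - 1/2)) * (\<Sum>k<n. ?\<phi> k (u k z)))"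
  have cmod_exp: "cmod (exp (l * (z - 1/2))) = exp (ln (real n) / 2 * (Re z - 1/2))" for z
    by (simp add: l_def)
  have u_line: "u k z = line col (\<lambda>i j. f i j z) k" for k z by (simp add: u_def line_def)
  have cont_u: "continuous_on strip (\<lambda>z. u k z m)" if "k < n" for k m by (rule coord(3)[OF u[OF that]])
  have der_u: "((\<lambda>z. u k z m) has_field_derivative nderiv (sum_space ?X0 ?X1) (u k) z m) (at z)"
    if "k < n" "z \<in> interior strip" for k m z by (rule coord(4)[OF u[OF that(1)] that(2)])
  have hol_u: "(\<lambda>z. u k z m) holomorphic_on interior strip" if "k < n" for k m
    unfolding holomorphic_on_def field_differentiable_def
    using der_u[OF that] has_field_derivative_at_within by blast
  have cont: "continuous_on strip h"
    unfolding h_def finite_functional_def by (intro continuous_intros cont_u) auto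
  have hol: "h holomorphic_on interior strip"
    unfolding h_def finite_functional_def by (intro holomorphic_intros hol_u) auto
  obtain b where b: "\<And>k z m. k < n \<Longrightarrow> z \<in> strip \<Longrightarrow> cmod (u k z m) \<le> b k"
    using coord(2)[OF u] by metis
  define B where "B = exp (ln (real n) / 2) * (\<Sum>k<n. \<Sum>m<P. b k * cmod (y k m))"
  have bdd: "cmod (h z) \<le> B" if z: "z \<in> strip" for z
    unfolding h_def norm_mult B_def
  proof (rule mult_mono)
    have "ln (real n) / 2 * (Re z - 1/2) \<le> ln (real n) / 2 * 1"
      using z n by (intro mult_left_mono) (auto simp: strip_def)
    then show "cmod (exp (l * (z - 1/2))) \<le> exp (ln (real n) / 2)"
      unfolding cmod_exp by simp
    show "cmod (\<Sum>k<n. ?\<phi> k (u k z)) \<le> (\<Sum>k<n. \<Sum>m<P. b k * cmod (y k m))"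
      unfolding finite_functional_def
      by (intro sum_norm_le) (simp add: norm_mult mult_right_mono b z)
  qed auto
  have sqrt_n: "sqrt (real n) = exp (ln (real n) / 2)" using n by (simp flip: ln_sqrt)
  have bdry: "cmod (h z) \<le> real n * a * M" if "Re z = 0 \<or> Re z = 1" for z
    using that
  proof
    assume z: "Re z = 0"
    define t where "t = Im z"
    have zt: "z = \<i> * of_real t" using z by (simp add: complex_eq_iff t_def)
    have "cmod (\<Sum>k<n. ?\<phi> k (u k z)) \<le> real n * a * (Q * M)"
      unfolding u_line
    proof (rule min_norm_pairing[OF n _ _ clinear_finite_functional a \<phi>])
      show "f i j z \<in> l2" if "i < n" "j < n" for i j
        using coord(1)[OF fij[OF that]] z by (simp add: strip_def)
      show "mnorm (min_os ell2) n (\<lambda>i j. f i j z) \<le> Q * M"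
        using calF_boundary_norms_bounded(1)[OF n f, of t] norm unfolding zt by linarith
    qed
    then have "cmod (h z) \<le> exp (ln (real n) / 2 * (0 - 1/2)) * (real n * a * (Q * M))"
      unfolding h_def norm_mult cmod_exp z by (intro mult_left_mono) auto
    also have "\<dots> = (exp (ln (real n) / 2 * (0 - 1/2)) * Q) * (real n * a * M)" by (simp add: mult_ac)
    also have "exp (ln (real n) / 2 * (0 - 1/2)) * Q = 1"
      unfolding Q_def exp_add[symmetric] by simp
    finally show ?thesis by simp
  next
    assume z: "Re z = 1"
    define t where "t = Im z"
    have zt: "z = 1 + \<i> * of_real t" using z by (simp add: complex_eq_iff t_def)
    have "cmod (\<Sum>k<n. ?\<phi> k (u k z)) \<le> sqrt (real n) * a * (Q * M)"
      unfolding u_line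
    proof (rule max_norm_pairing[OF n _ _ clinear_finite_functional less_imp_le[OF a] \<phi>])
      show "f i j z \<in> l2" if "i < n" "j < n" for i j
        using coord(1)[OF fij[OF that]] z by (simp add: strip_def)
      show "mnorm (max_os ell2) n (\<lambda>i j. f i j z) < Q * M"
        using calF_boundary_norms_bounded(2)[OF n f, of t] norm unfolding zt by linarith
    qed
    then have "cmod (h z) \<le> exp (ln (real n) / 2 * (1 - 1/2)) * (sqrt (real n) * a * (Q * M))"
      unfolding h_def norm_mult cmod_exp z by (intro mult_left_mono) auto
    also have "\<dots> = (exp (ln (real n) / 2 * (1 - 1/2)) * Q * sqrt (real n)) * (a * M)" by (simp add: mult_ac)
    also have "exp (ln (real n) / 2 * (1 - 1/2)) * Q * sqrt (real n) = real n"
      using n unfolding sqrt_n Q_def exp_add[symmetric] by simp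
    finally show ?thesis by (simp add: mult_ac)
  qed
  have fst: "u k (1/2) = fst (line col X k)" and snd: "nderiv (sum_space ?X0 ?X1) (u k) (1/2) = snd (line col X k)"
    if "k < n" for k
    using val der n that by (auto simp: u_def line_def)
  have "((\<lambda>z. ?\<phi> k (u k z)) has_field_derivative ?\<phi> k (snd (line col X k))) (at (1/2))" if "k < n" for k
    unfolding finite_functional_def snd[OF that, symmetric]
    by (intro DERIV_sum DERIV_cmult_right der_u that half_interior_strip)
  then have S: "((\<lambda>z. \<Sum>k<n. ?\<phi> k (u k z)) has_field_derivative (\<Sum>k<n. ?\<phi> k (snd (line col X k)))) (at (1/2))"
    by (intro DERIV_sum) auto
  have E: "((\<lambda>z. exp (l * (z - 1/2))) has_field_derivative l) (at (1/2))"
    by (auto intro!: derivative_eq_intros)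
  have "(h has_field_derivative (\<Sum>k<n. ?\<phi> k (snd (line col X k))) + l * (\<Sum>k<n. ?\<phi> k (fst (line col X k)))) (at (1/2))"
    unfolding h_def using DERIV_mult[OF E S] fst by (simp add: add.commute mult.commute)
  from strip_derivative_bound[OF cont hol bdd bdry this] show ?thesis by (simp add: l_def)
qed

text \<open>The numbers \<open>\<langle>d, \<alpha> e\<^sub>k\<rangle>\<close> are coordinates of the image of the truncated \<open>d\<close> under the adjoint of \<open>\<alpha>\<close>. The
  adjoint is avoided by testing with the vector \<open>v\<close> that has these coordinates: the sum of their squares is
  \<open>\<langle>d, \<alpha> v\<rangle>\<close>, which is at most \<open>a \<parallel>d\<parallel> \<parallel>v\<parallel>\<close>.\<close>

lemma test_functional_bound:
  assumes lin: "clinear_on l2 \<alpha>" and \<alpha>: "\<And>x. x \<in> l2 \<Longrightarrow> \<alpha> x \<in> l2 \<and> l2norm (\<alpha> x) \<le> a * l2norm x"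
    and d: "d \<in> l2" and a: "0 \<le> a"
  shows "L2_set (\<lambda>k. cmod (finite_functional P (\<alpha> (unit_vec k)) d)) {..<n} \<le> a * l2norm d"
proof -
  let ?\<phi> = "\<lambda>k. finite_functional P (\<alpha> (unit_vec k)) d"
  define S where "S = L2_set (\<lambda>k. cmod (?\<phi> k)) {..<n}"
  define v where "v = (\<Sum>k<n. ?\<phi> k *\<^sub>C unit_vec k)"
  have v: "v \<in> l2" unfolding v_def using l2_sum[of "{..<n}" unit_vec ?\<phi>] unit_vec_l2 by blast
  have vn: "l2norm v = S" unfolding v_def S_def by (rule l2norm_sum_unit_vec)
  have \<alpha>v: "\<alpha> v m = (\<Sum>k<n. ?\<phi> k * \<alpha> (unit_vec k) m)" for m
    unfolding v_def using clinear_on_sum[OF lin, of "{..<n}" unit_vec ?\<phi>] unit_vec_l2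
    by (simp add: sum_fun_apply scaleC_fun_def scaleC_complex_def)
  have "complex_of_real (S\<^sup>2) = (\<Sum>k<n. cnj (?\<phi> k) * ?\<phi> k)"
    by (simp add: S_def L2_set_def sum_nonneg complex_norm_square mult.commute del: of_real_power)
  also have "\<dots> = (\<Sum>k<n. \<Sum>m<P. cnj (?\<phi> k) * (d m * cnj (\<alpha> (unit_vec k) m)))"
    by (subst (2) finite_functional_def) (simp add: sum_distrib_left)
  also have "\<dots> = (\<Sum>m<P. d m * cnj (\<alpha> v m))"
    by (subst sum.swap) (simp add: \<alpha>v sum_distrib_left mult_ac)
  finally have "S\<^sup>2 = cmod (\<Sum>m<P. d m * cnj (\<alpha> v m))" by (metis abs_power2 norm_of_real)
  also have "\<dots> \<le> (\<Sum>m<P. \<bar>cmod (d m)\<bar> * \<bar>cmod (\<alpha> v m)\<bar>)"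
    by (rule order.trans[OF norm_sum]) (simp add: norm_mult)
  also have "\<dots> \<le> L2_set (\<lambda>m. cmod (d m)) {..<P} * L2_set (\<lambda>m. cmod (\<alpha> v m)) {..<P}"
    by (rule L2_set_mult_ineq)
  also have "\<dots> \<le> l2norm d * l2norm (\<alpha> v)"
    using \<alpha>[OF v] d by (intro mult_mono truncation_le_l2norm) (auto simp: l2norm_nonneg)
  also have "\<dots> \<le> l2norm d * (a * S)"
    using \<alpha>[OF v] d by (intro mult_left_mono) (auto simp: l2norm_nonneg vn)
  finally have "S * S \<le> (a * l2norm d) * S" by (simp add: power2_eq_square mult_ac)
  moreover have "0 \<le> S" by (simp add: S_def)
  ultimately have "S \<le> a * l2norm d"
    using a l2norm_nonneg[OF d] by (cases "S = 0") auto
  then show ?thesis by (simp add: S_def)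
qed

section \<open>Comparison of the two extensions\<close>

lemma completely_bounded_OH:
  assumes "completely_bounded OH OH T"
  shows "clinear_on l2 T" and "\<exists>a>0. \<forall>x\<in>l2. T x \<in> l2 \<and> l2norm (T x) \<le> a * l2norm x"
proof -
  have car: "carrier OH = l2" by (simp add: OH_def)
  show "clinear_on l2 T" using assms by (simp add: completely_bounded_def car)
  have Tl: "T x \<in> l2" if "x \<in> l2" for x using assms that by (auto simp: completely_bounded_def car)
  obtain K where K: "\<forall>n. \<forall>x\<in>mats n l2. mnorm OH n (\<lambda>i j. T (x i j)) \<le> K * mnorm OH n x"
    using assms unfolding completely_bounded_def car by blast
  have "l2norm (T x) \<le> (\<bar>K\<bar> + 1) * l2norm x" if x: "x \<in> l2" for x
  proof -
    let ?x = "\<lambda>i j::nat. if i = 0 \<and> j = (0::nat) then x else 0"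
    have xm: "?x \<in> mats 1 l2" using x by (auto simp: mats_def)
    have "mnorm OH 1 (\<lambda>i j. T (?x i j)) \<le> K * mnorm OH 1 ?x" using bspec[OF spec[OF K] xm] .
    then have "l2norm (T x) \<le> K * l2norm x"
      using mnorm_OH_1[of ?x] mnorm_OH_1[of "\<lambda>i j. T (?x i j)"] x Tl[OF x] by simp
    also have "\<dots> \<le> (\<bar>K\<bar> + 1) * l2norm x"
      by (intro mult_right_mono l2norm_nonneg x) simp
    finally show ?thesis .
  qed
  then show "\<exists>a>0. \<forall>x\<in>l2. T x \<in> l2 \<and> l2norm (T x) \<le> a * l2norm x"
    using Tl by (intro exI[of _ "\<bar>K\<bar> + 1"]) auto
qed

lemma complete_isomorphism_OH_bounds:
  assumes "complete_isomorphism OH OH T"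
  obtains a b where "clinear_on l2 T" "a > 0" "\<And>x. x \<in> l2 \<Longrightarrow> T x \<in> l2 \<and> l2norm (T x) \<le> a * l2norm x"
    "b > 0" "\<And>x. x \<in> l2 \<Longrightarrow> l2norm x \<le> b * l2norm (T x)"
proof -
  have car: "carrier OH = l2" by (simp add: OH_def)
  have bij: "bij_betw T l2 l2" and T: "completely_bounded OH OH T"
    and T': "completely_bounded OH OH (inv_into l2 T)"
    using assms by (auto simp: complete_isomorphism_def car)
  obtain a where a: "a > 0" "\<forall>x\<in>l2. T x \<in> l2 \<and> l2norm (T x) \<le> a * l2norm x"
    using completely_bounded_OH(2)[OF T] by blast
  obtain b where b: "b > 0" "\<forall>x\<in>l2. l2norm (inv_into l2 T x) \<le> b * l2norm x"
    using completely_bounded_OH(2)[OF T'] by blast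
  have "l2norm x \<le> b * l2norm (T x)" if "x \<in> l2" for x
    using b(2) a(2) that bij by (metis bij_betw_inv_into_left)
  then show thesis using that completely_bounded_OH(1)[OF T] a b(1) by blast
qed

text \<open>The images of the column and of the row have the same first components, and their second components
  differ by \<open>- ln n \<cdot> \<alpha> e\<^sub>k\<close>. Subtraction of the two instances of \<open>do_ell2_line_estimate\<close> removes the
  unknown map \<open>\<gamma>\<close> as well as the values of \<open>\<beta>\<close> that are not determined by \<open>\<alpha>\<close>.\<close>

lemma truncated_energy_bound:
  assumes \<alpha>: "complete_isomorphism OH OH \<alpha>" and \<beta>: "complete_isomorphism dOH do_ell2 \<beta>"
    and sub: "\<And>y. y \<in> l2 \<Longrightarrow> \<beta> (0, y) = (0, \<alpha> y)"
    and quot: "\<And>x. x \<in> carrier dOH \<Longrightarrow> fst (\<beta> x) = \<gamma> (fst x)"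
  shows "\<exists>C. \<forall>n>0. \<forall>P. ln (real n) * (\<Sum>k<n. \<Sum>m<P. (cmod (\<alpha> (unit_vec k) m))\<^sup>2) \<le> C * real n"
proof -
  obtain a where lin: "clinear_on l2 \<alpha>" and a: "a > 0"
    and bound: "\<And>x. x \<in> l2 \<Longrightarrow> \<alpha> x \<in> l2 \<and> l2norm (\<alpha> x) \<le> a * l2norm x"
    using complete_isomorphism_OH_bounds[OF \<alpha>] by metis
  have cb: "completely_bounded dOH do_ell2 \<beta>" using \<beta> by (simp only: complete_isomorphism_def)
  then have lin\<beta>: "clinear_on (carrier dOH) \<beta>" and img: "\<beta> ` carrier dOH \<subseteq> carrier do_ell2"
    by (simp_all only: completely_bounded_def)
  obtain K where K: "\<forall>n. \<forall>x\<in>mats n (carrier dOH). mnorm do_ell2 n (\<lambda>i j. \<beta> (x i j)) \<le> K * mnorm dOH n x"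
    using cb unfolding completely_bounded_def by (elim conjE exE)
  define M where "M = \<bar>K\<bar> + 1"
  have "ln (real n) * (\<Sum>k<n. \<Sum>m<P. (cmod (\<alpha> (unit_vec k) m))\<^sup>2) \<le> (4 * a * M) * real n"
    if n: "n > 0" for n P
  proof -
    let ?e = "unit_vec"
    let ?\<phi> = "\<lambda>k. finite_functional P (\<alpha> (?e k))"
    define L where "L = complex_of_real (ln (real n))"
    define X where "X = (\<lambda>col i j. \<beta> (test_matrix col n i j))"
    have test: "test_matrix col n i j \<in> carrier dOH" if "i < n" "j < n" for col i j
      using test_matrix_mats[OF n, of col] that by (auto simp: mats_def)
    have car: "X col i j \<in> carrier do_ell2" if "i < n" "j < n" for col i j
      unfolding X_def by (rule subsetD[OF img imageI[OF test[OF that]]])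
    have norm: "mnorm do_ell2 n (X col) < exp (ln (real n) / 4) * M" for col
    proof -
      define Q where "Q = exp (ln (real n) / 4)"
      have Q: "Q > 0" by (simp add: Q_def)
      have "mnorm do_ell2 n (X col) \<le> K * mnorm dOH n (test_matrix col n)"
        unfolding X_def using bspec[OF spec[OF K] test_matrix_mats[OF n]] .
      moreover have "0 \<le> mnorm dOH n (test_matrix col n)" by (rule test_matrix_norm(2)[OF n])
      then have "K * mnorm dOH n (test_matrix col n) \<le> \<bar>K\<bar> * Q"
        by (intro mult_mono test_matrix_norm(1)[OF n, folded Q_def]) auto
      moreover have "\<bar>K\<bar> * Q < Q * M" using Q by (simp add: M_def algebra_simps)
      ultimately show ?thesis unfolding Q_def by linarith
    qed
    define S where "S = (\<lambda>col. \<Sum>k<n. ?\<phi> k (snd (line col (X col) k)))"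
    define T where "T = (\<lambda>col. \<Sum>k<n. ?\<phi> k (fst (line col (X col) k)))"
    have est: "cmod (S col + L / 2 * T col) \<le> 2 * (real n * a * M)" for col
      using do_ell2_line_estimate[OF n car norm a test_functional_bound[OF lin bound _ less_imp_le[OF a]], of P col]
      unfolding S_def T_def L_def by simp
    define p where "p = (\<lambda>col k. (?e k, complex_of_real (half_log col n) *\<^sub>C ?e k))"
    have p: "p col k \<in> carrier dOH" for col k
      unfolding p_def by (rule dOH_graph_mem[OF unit_vec_l2])
    have line: "line col (X col) k = \<beta> (p col k)" if "k < n" for col k
      using that n by (simp add: line_def X_def place_def p_def)
    have fst_line: "fst (line col (X col) k) = \<gamma> (?e k)" if "k < n" for col k
      unfolding line[OF that] quot[OF p] by (simp add: p_def)
    have T: "T True = T False" by (simp add: T_def fst_line)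
    \<comment> \<open>The difference of the two pairs \<open>(e\<^sub>k, - (ln n / 2) e\<^sub>k)\<close> and \<open>(e\<^sub>k, (ln n / 2) e\<^sub>k)\<close> lies in the
      image of the inclusion, where \<open>\<beta>\<close> is given by \<open>\<alpha>\<close>.\<close>
    have snd_line: "snd (line True (X True) k) = snd (line False (X False) k) + (- L) *\<^sub>C \<alpha> (?e k)" if k: "k < n" for k
    proof -
      have ek: "(- L) *\<^sub>C ?e k \<in> l2" by (intro l2_scale unit_vec_l2)
      have zero: "(0, (- L) *\<^sub>C ?e k) = p True k + (- 1) *\<^sub>C p False k"
        by (simp add: p_def L_def scaleC_prod_def scaleC_fun_def scaleC_complex_def fun_eq_iff)
      have neg: "(- 1) *\<^sub>C p False k \<in> carrier dOH"
        using dOH_graph_mem[OF l2_scale[OF unit_vec_l2, of "- 1" k], of "half_log False n"]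
        by (simp add: p_def scaleC_prod_def scaleC_scaleC)
      have "(0, \<alpha> ((- L) *\<^sub>C ?e k)) = \<beta> (p True k + (- 1) *\<^sub>C p False k)"
        unfolding zero[symmetric] by (rule sub[OF ek, symmetric])
      also have "\<dots> = \<beta> (p True k) + (- 1) *\<^sub>C \<beta> (p False k)"
        using lin\<beta> p neg unfolding clinear_on_def by metis
      finally have "\<alpha> ((- L) *\<^sub>C ?e k) = snd (\<beta> (p True k)) - snd (\<beta> (p False k))"
        by (simp add: prod_eq_iff scaleC_prod_def scaleC_fun_def scaleC_complex_def fun_eq_iff)
      moreover have "\<alpha> ((- L) *\<^sub>C ?e k) = (- L) *\<^sub>C \<alpha> (?e k)"
        using lin unit_vec_l2 unfolding clinear_on_def by blast
      ultimately show ?thesis unfolding line[OF k] by (simp add: algebra_simps)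
    qed
    define E where "E = (\<Sum>k<n. \<Sum>m<P. (cmod (\<alpha> (?e k) m))\<^sup>2)"
    have self: "?\<phi> k (\<alpha> (?e k)) = complex_of_real (\<Sum>m<P. (cmod (\<alpha> (?e k) m))\<^sup>2)" for k
      by (simp add: finite_functional_def complex_norm_square del: of_real_power)
    have "S True = (\<Sum>k<n. ?\<phi> k (snd (line False (X False) k)) + (- L) * ?\<phi> k (\<alpha> (?e k)))"
      unfolding S_def
    proof (rule sum.cong)
      fix k assume "k \<in> {..<n}"
      then show "?\<phi> k (snd (line True (X True) k)) = ?\<phi> k (snd (line False (X False) k)) + (- L) * ?\<phi> k (\<alpha> (?e k))"
        using clinear_finite_functional[of UNIV P "\<alpha> (?e k)"] unfolding clinear_on_def
        by (simp add: snd_line scaleC_complex_def)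
    qed simp
    also have "\<dots> = S False + (- L) * complex_of_real E"
      by (simp only: S_def E_def self sum.distrib sum_distrib_left of_real_sum)
    finally have LE: "L * complex_of_real E = S False + L / 2 * T False - (S True + L / 2 * T True)"
      by (simp add: T)
    have "cmod (L * complex_of_real E) \<le> 2 * (real n * a * M) + 2 * (real n * a * M)"
      unfolding LE by (rule order.trans[OF norm_triangle_ineq4 add_mono]) (rule est)+
    moreover have "ln (real n) * E \<le> cmod (L * complex_of_real E)"
      by (simp add: L_def norm_mult abs_mult[symmetric])
    ultimately show ?thesis unfolding E_def by (simp add: mult_ac)
  qed
  then show ?thesis by blast
qed

theorem theorem5p4:
  "\<not> completely_isomorphically_equivalent (pair_extension OH dOH) (pair_extension OH do_ell2)"
proof
  assume "completely_isomorphically_equivalent (pair_extension OH dOH) (pair_extension OH do_ell2)"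
  then obtain \<alpha> \<beta> \<gamma> where \<alpha>: "complete_isomorphism OH OH \<alpha>" and \<beta>: "complete_isomorphism dOH do_ell2 \<beta>"
    and sub: "\<forall>y\<in>carrier OH. \<beta> (0, y) = (0, \<alpha> y)"
    and quot: "\<forall>x\<in>carrier dOH. fst (\<beta> x) = \<gamma> (fst x)"
    unfolding completely_isomorphically_equivalent_def pair_extension_def extension.simps by (elim exE conjE)
  have car: "carrier OH = l2" by (simp add: OH_def)
  have "\<exists>C. \<forall>n>0. \<forall>P. ln (real n) * (\<Sum>k<n. \<Sum>m<P. (cmod (\<alpha> (unit_vec k) m))\<^sup>2) \<le> C * real n"
    by (rule truncated_energy_bound[OF \<alpha> \<beta>]) (use sub quot car in auto)
  then obtain C where C: "\<And>n P. n > 0 \<Longrightarrow>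
      ln (real n) * (\<Sum>k<n. \<Sum>m<P. (cmod (\<alpha> (unit_vec k) m))\<^sup>2) \<le> C * real n"
    by blast
  obtain b where \<alpha>l: "\<And>x. x \<in> l2 \<Longrightarrow> \<alpha> x \<in> l2" and b: "b > 0"
    and below: "\<And>x. x \<in> l2 \<Longrightarrow> l2norm x \<le> b * l2norm (\<alpha> x)"
    using complete_isomorphism_OH_bounds[OF \<alpha>] by metis
  have log_bound: "ln (real n) \<le> C * b\<^sup>2" if n: "n > 0" for n :: nat
  proof -
    have "(\<lambda>P. ln (real n) * (\<Sum>k<n. \<Sum>m<P. (cmod (\<alpha> (unit_vec k) m))\<^sup>2)) \<longlonglongrightarrow>
        ln (real n) * (\<Sum>k<n. (l2norm (\<alpha> (unit_vec k)))\<^sup>2)"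
    proof (intro tendsto_intros)
      fix k
      show "(\<lambda>P. \<Sum>m<P. (cmod (\<alpha> (unit_vec k) m))\<^sup>2) \<longlonglongrightarrow> (l2norm (\<alpha> (unit_vec k)))\<^sup>2"
        using \<alpha>l[OF unit_vec_l2, of k] unfolding l2norm_power2[OF \<alpha>l[OF unit_vec_l2]]
        by (intro summable_LIMSEQ) (simp add: l2_iff)
    qed
    then have "ln (real n) * (\<Sum>k<n. (l2norm (\<alpha> (unit_vec k)))\<^sup>2) \<le> C * real n"
      by (rule LIMSEQ_le_const2) (use C[OF n] in blast)
    moreover have "(\<Sum>k<n. (1 / b)\<^sup>2) \<le> (\<Sum>k<n. (l2norm (\<alpha> (unit_vec k)))\<^sup>2)"
    proof (intro sum_mono power_mono)
      fix k
      show "1 / b \<le> l2norm (\<alpha> (unit_vec k))"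
        using below[OF unit_vec_l2, of k] b by (simp add: l2norm_unit_vec field_simps)
    qed (use b in simp)
    then have "ln (real n) * (\<Sum>k<n. (1 / b)\<^sup>2) \<le> ln (real n) * (\<Sum>k<n. (l2norm (\<alpha> (unit_vec k)))\<^sup>2)"
      using n by (intro mult_left_mono) auto
    ultimately have "real n * (ln (real n) * (1 / b)\<^sup>2) \<le> real n * C" by (simp add: mult_ac)
    then have "ln (real n) * (1 / b)\<^sup>2 \<le> C" using n by simp
    then show ?thesis using b by (simp add: field_simps)
  qed
  obtain n where n: "exp (C * b\<^sup>2) < real n" using reals_Archimedean2 by blast
  then have "real n > 0" using exp_gt_zero[of "C * b\<^sup>2"] by linarith
  then have "C * b\<^sup>2 < ln (real n)" using n by (metis exp_less_cancel_iff exp_ln)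
  with log_bound[of n] \<open>real n > 0\<close> show False by simp
qed

end
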